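(* Let $X$ be a compact metric space that is a connected graphoid. Then the set of all $f\in\mathcal C(X)$ having the $\mathcal T_S$-bi-shadowing property (that is, having both the shadowing property and the $\mathcal T_S$-inverse shadowing property) is generic in $\mathcal C(X)$, i.e. it contains a dense $G_\delta$ subset of $\mathcal C(X)$.
   Context: Let $(X,d)$ be a compact metric space. $\mathcal C(X)$ denotes the set of all continuous functions $X\to X$, with the metric $\rho(f,g)=\sup_{x\in X}d(f(x),g(x))$. A subset of $\mathcal C(X)$ is called generic if it contains a dense $G_\delta$ subset of $\mathcal C(X)$. Here $\omega=\{0,1,2,\dots\}$ and $X^\omega$ is the set of all one-sided sequences in $X$. Graphs and graphoids. A graph $G$ is a compact, connected space for which there exist finitely many arcs $I_1,\dots,I_n$ such that $G=\bigcup_{j=1}^n I_j$ and, for $j\neq k$, $I_j\cap I_k$ is a subset of the set of endpoints of $I_j$. The space $X$ is a graphoid if for every $\varepsilon>0$ there exist a graph $G\subseteq X$ and a retraction $r_G:X\to G$ (a continuous map with $r_G(x)=x$ for all $x\in G$) that is an $\varepsilon$-map, i.e. $\mathrm{diam}(r_G^{-1}(x))<\varepsilon$ for each $x\in G$. Shadowing. Let $f\in\mathcal C(X)$. The orbit of $x\in X$ under $f$ is the sequence $\langle f^i(x)\rangle_{i\in\omega}$. For $\delta>0$, a $\delta$-pseudo-orbit of $f$ is a sequence $\langle x_i\rangle_{i\in\omega}$ in $X$ such that $d(f(x_i),x_{i+1})<\delta$ for all $i\in\omega$. For $\varepsilon>0$, a point $z\in X$ $\varepsilon$-shadows a sequence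 $\langle x_i\rangle_{i\in\omega}$ if $d(f^i(z),x_i)<\varepsilon$ for all $i\in\omega$. The map $f$ has the shadowing property if for every $\varepsilon>0$ there exists $\delta>0$ such that every $\delta$-pseudo-orbit of $f$ is $\varepsilon$-shadowed by some point of $X$. Inverse shadowing. A $\delta$-method for $f$ is a map $\chi:X\to X^\omega$ (not required to be continuous) such that for all $x\in X$, the sequence $\chi(x)=\langle\chi(x)_n\rangle_{n\in\omega}$ is a $\delta$-pseudo-orbit of $f$ with $\chi(x)_0=x$. The class $\mathcal T_S$ consists of those methods $\chi$ for which there exists a family of continuous maps $\psi_n\in\mathcal C(X)$, $n\in\omega$, such that $\psi_n(\chi(x)_n)=\chi(x)_{n+1}$ for all $n\in\omega$ and all $x\in X$. The map $f$ has the $\mathcal T_S$-inverse shadowing property if for every $\varepsilon>0$ there is some $\delta>0$ such that for every $\delta$-method $\chi\in\mathcal T_S$ for $f$ and every point $x\in X$, there is some $y\in X$ such that the sequence $\chi(y)$ $\varepsilon$-shadows the orbit of $x$, i.e. $d(\chi(y)_i,f^i(x))<\varepsilon$ for all $i\in\omega$. Bi-shadowing. The map $f$ has the $\mathcal T_S$-bi-shadowing property if it has both the shadowing property and the $\mathcal T_S$-inverse shadowing property. *)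

theory Defs
  imports "HOL-Analysis.Analysis"
begin

text \<open>
  The space $X$ is the universe of a type of class \<^class>\<open>metric_space\<close>, assumed compact in the
  theorem.  The metric space of continuous maps $X \to X$ is the library type of bounded continuous
  functions, whose distance is the supremum metric; on a compact space boundedness is automatic.
\<close>

definition generic :: "'b::topological_space set \<Rightarrow> bool" where
  "generic S \<longleftrightarrow> (\<exists>D. D \<subseteq> S \<and> gdelta D \<and> closure D = UNIV)"


text \<open>
  The library predicate \<^const>\<open>arc\<close> speaks about an injective parametrisation on the unit interval;
  the arc as a set is its path image, and its endpoints are the values at 0 and 1.
\<close>

definition graph :: "'a::metric_space set \<Rightarrow> bool" where
  "graph G \<longleftrightarrow>
     compact G \<and> connected G \<and>
     (\<exists>(n::nat) (\<gamma> :: nat \<Rightarrow> real \<Rightarrow> 'a). n \<ge> 1 \<and>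
        (\<forall>j\<in>{1..n}. arc (\<gamma> j)) \<and>
        G = (\<Union>j\<in>{1..n}. path_image (\<gamma> j)) \<and>
        (\<forall>j\<in>{1..n}. \<forall>k\<in>{1..n}. j \<noteq> k \<longrightarrow>
           path_image (\<gamma> j) \<inter> path_image (\<gamma> k) \<subseteq> {pathstart (\<gamma> j), pathfinish (\<gamma> j)}))"

definition graphoid :: "'a::metric_space set \<Rightarrow> bool" where
  "graphoid X \<longleftrightarrow>
     (\<forall>\<epsilon>>0. \<exists>G r. graph G \<and> retraction X G r \<and>
        (\<forall>x\<in>G. diameter {y \<in> X. r y = x} < \<epsilon>))"


definition orbit_seq :: "('a \<Rightarrow> 'a) \<Rightarrow> 'a \<Rightarrow> nat \<Rightarrow> 'a" where
  "orbit_seq f x = (\<lambda>i. (f ^^ i) x)"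

definition pseudo_orbit :: "('a::metric_space \<Rightarrow> 'a) \<Rightarrow> real \<Rightarrow> (nat \<Rightarrow> 'a) \<Rightarrow> bool" where
  "pseudo_orbit f \<delta> s \<longleftrightarrow> (\<forall>i. dist (f (s i)) (s (Suc i)) < \<delta>)"

text \<open>A point shadows a sequence when its orbit does so in the following sense.\<close>

definition seq_shadows :: "real \<Rightarrow> (nat \<Rightarrow> 'a::metric_space) \<Rightarrow> (nat \<Rightarrow> 'a) \<Rightarrow> bool" where
  "seq_shadows \<epsilon> s t \<longleftrightarrow> (\<forall>i. dist (s i) (t i) < \<epsilon>)"

definition shadowing :: "('a::metric_space \<Rightarrow> 'a) \<Rightarrow> bool" where
  "shadowing f \<longleftrightarrow>
     (\<forall>\<epsilon>>0. \<exists>\<delta>>0. \<forall>s. pseudo_orbit f \<delta> s \<longrightarrow> (\<exists>z. seq_shadows \<epsilon> (orbit_seq f z) s))"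

definition delta_method :: "('a::metric_space \<Rightarrow> 'a) \<Rightarrow> real \<Rightarrow> ('a \<Rightarrow> nat \<Rightarrow> 'a) \<Rightarrow> bool" where
  "delta_method f \<delta> \<xi> \<longleftrightarrow> (\<forall>x. pseudo_orbit f \<delta> (\<xi> x) \<and> \<xi> x 0 = x)"

definition T_S :: "('a::metric_space \<Rightarrow> nat \<Rightarrow> 'a) set" where
  "T_S = {\<xi>. \<exists>\<psi> :: nat \<Rightarrow> 'a \<Rightarrow> 'a.
            (\<forall>n. continuous_on UNIV (\<psi> n)) \<and> (\<forall>n x. \<psi> n (\<xi> x n) = \<xi> x (Suc n))}"

definition T_S_inverse_shadowing :: "('a::metric_space \<Rightarrow> 'a) \<Rightarrow> bool" where
  "T_S_inverse_shadowing f \<longleftrightarrow>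
     (\<forall>\<epsilon>>0. \<exists>\<delta>>0. \<forall>\<xi>. delta_method f \<delta> \<xi> \<and> \<xi> \<in> T_S \<longrightarrow>
        (\<forall>x. \<exists>y. seq_shadows \<epsilon> (\<xi> y) (orbit_seq f x)))"

definition T_S_bi_shadowing :: "('a::metric_space \<Rightarrow> 'a) \<Rightarrow> bool" where
  "T_S_bi_shadowing f \<longleftrightarrow> shadowing f \<and> T_S_inverse_shadowing f"

end

theory Submission
  imports Defs
begin

text \<open>
  Shadowing and inverse shadowing are two readings of one property.  Say that $g$ \<^emph>\<open>traces
  robustly\<close> with constants $\<delta>,\<epsilon>$ if for every $\<delta>$-pseudo-orbit $s$ of $g$ and every
  sequence of continuous maps $H_0 = id, H_1, H_2, \<dots>$ such that $(H_n(y))_n$ is a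
  $\<delta>$-pseudo-orbit of $g$ for every $y$, some $y$ satisfies $d(H_n(y), s_n) < \<epsilon>$ for all $n$.
  If $h$ is uniformly close to $g$, then taking $H_n = h^n$ gives shadowing for $h$ at the scale
  $\<epsilon>$, and taking for $H_n$ the $n$-th coordinate of a method in $T_S$ (it is
  continuous, being a composition of the $\<psi>_k$) and for $s$ an orbit of $h$ gives inverse shadowing.  So
  the maps within $\<delta>/2$ of a robustly tracing map form an open set of maps that are good at scale
  $\<epsilon>$.  Since $C(X)$ is complete, Baire's theorem reduces everything to density:
  any map can be perturbed slightly so that it traces robustly at a given scale
  (\<open>generic_bi_shadowing_if_dense_robust_tracing\<close>, \<open>dense_robust_tracing_graphoid\<close>).

  Robust tracing comes from a one-dimensional covering argument
  (\<open>covering_imp_traces_robustly\<close>).  Cover $X$ by finitely many small closed sets $N_v$ and give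
  each a coordinate $u_v : X \<rightarrow> [0,1]$ supported in $N_v$.  Suppose that for each $v$ there is a
  set $S(v)$ of indices such that $g(N_v)$ lies in the interior of $\<Union>_{w \<in> S(v)} N_w$, so that a
  pseudo-orbit visiting $N_v$ next visits some $N_w$ with $w \<in> S(v)$; and suppose that, as $u_v$ crosses
  the strip $[1/3,2/3]$, the coordinate $u_w \<circ> g$ takes both values $0$ and $1$ for every $w \<in> S(v)$.  The
  crossing survives errors of size $\<delta>$, so nested parameter intervals of one fixed path
  produce a point whose trajectory under $(H_n)$ follows the itinerary of the pseudo-orbit.

  It remains to arrange these conditions near a given $f$.  Retract $X$ by $r$ onto a graph $G$ close to $X$,
  replace $f$ by $F \<circ> r$ with $F = r \<circ> f$, and subdivide $G$ into very short edges.  Split each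
  edge into thirds: the middle thirds are pairwise disjoint cores, and the outer thirds form
  disjoint stars around the vertices.  The new map agrees with $F$ up to reparametrisation on the
  stars, while on the core of the edge $j$ it runs through a small path-connected set, the spread of $j$,
  visiting every core that this set meets.  The division into two disjoint families is what defeats the usual
  difficulty at the boundary of an image: the spread contains every core it touches, and every star it
  touches is adjacent to such a core, so a pseudo-orbit can never escape to a region that is
  not covered (\<open>targets_absorb\<close>, \<open>robustly_tracing_map\<close>).
\<close>

section \<open>Functions crossing a strip\<close>

text \<open>
  Take the last time at which the function is at most $l$, and after it the first time at which it is
  at least $h$.
\<close>
lemma crossing_subinterval_aux:
  fixes \<psi> :: "real \<Rightarrow> real"
  assumes cont: "continuous_on {s..t} \<psi>" and "s \<le> t" "\<psi> s \<le> l" "h \<le> \<psi> t" "l \<le> h"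
  obtains a b where "s \<le> a" "a \<le> b" "b \<le> t" "\<psi> ` {a..b} = {l..h}"
proof -
  define K where "K = {x \<in> {s..t}. \<psi> x \<le> l}"
  have "closed K"
    unfolding K_def using cont by (intro continuous_on_closed_Collect_le) (auto intro: continuous_intros)
  then have "compact K"
    by (auto simp: compact_eq_bounded_closed K_def intro: bounded_subset[OF bounded_closed_interval[of s t]])
  moreover have "s \<in> K"
    using assms by (auto simp: K_def)
  ultimately obtain a where a: "a \<in> K" and amax: "\<And>x. x \<in> K \<Longrightarrow> x \<le> a"
    using compact_attains_sup[of K] by blast
  have a': "s \<le> a" "a \<le> t" "\<psi> a \<le> l" using a by (auto simp: K_def)
  have conta: "continuous_on {a..t} \<psi>"
    using a' by (auto intro: continuous_on_subset[OF cont])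
  define L where "L = {x \<in> {a..t}. h \<le> \<psi> x}"
  have "closed L"
    unfolding L_def using conta by (intro continuous_on_closed_Collect_le) (auto intro: continuous_intros)
  then have "compact L"
    by (auto simp: compact_eq_bounded_closed L_def intro: bounded_subset[OF bounded_closed_interval[of a t]])
  moreover have "t \<in> L"
    using assms a' by (auto simp: L_def)
  ultimately obtain b where b: "b \<in> L" and bmin: "\<And>x. x \<in> L \<Longrightarrow> b \<le> x"
    using compact_attains_inf[of L] by blast
  have b': "a \<le> b" "b \<le> t" "h \<le> \<psi> b" using b by (auto simp: L_def)
  have contb: "continuous_on {a..b} \<psi>"
    using b' by (auto intro: continuous_on_subset[OF conta])
  have below: "l \<le> \<psi> x" if x: "x \<in> {a..b}" for x
  proof (rule ccontr)
    assume n: "\<not> l \<le> \<psi> x"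
    obtain y where y: "x \<le> y" "y \<le> t" "\<psi> y = l"
    proof (rule IVT'[of \<psi> x l t, THEN exE])
      show "continuous_on {x..t} \<psi>" using x by (intro continuous_on_subset[OF conta]) auto
    qed (use n assms(4,5) x b'(2) in auto)
    then have "y \<in> K" using a' that by (auto simp: K_def)
    with amax[of y] y x have "y = x" by auto
    with y n show False by simp
  qed
  have above: "\<psi> x \<le> h" if x: "x \<in> {a..b}" for x
  proof (rule ccontr)
    assume n: "\<not> \<psi> x \<le> h"
    obtain y where y: "a \<le> y" "y \<le> x" "\<psi> y = h"
    proof (rule IVT'[of \<psi> a h x, THEN exE])
      show "continuous_on {a..x} \<psi>" using x by (intro continuous_on_subset[OF contb]) auto
    qed (use n assms(5) x a'(3) in auto)
    then have "y \<in> L" using b' that by (auto simp: L_def)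
    with bmin[of y] y x have "y = x" by auto
    with y n show False by simp
  qed
  have "\<exists>x\<in>{a..b}. \<psi> x = y" if "y \<in> {l..h}" for y
    using IVT'[of \<psi> a y b] that a'(3) b'(1,3) contb by fastforce
  then have "{l..h} \<subseteq> \<psi> ` {a..b}" by blast
  moreover have "\<psi> ` {a..b} \<subseteq> {l..h}" using below above by auto
  ultimately have "\<psi> ` {a..b} = {l..h}" by (rule equalityI[rotated])
  with that a' b' show ?thesis by blast
qed

text \<open>
  The two prescribed times may come in either order; time reversal reduces to the ordered case.
\<close>
lemma crossing_subinterval:
  fixes \<psi> :: "real \<Rightarrow> real"
  assumes cont: "continuous_on {a..b} \<psi>" and st: "s \<in> {a..b}" "t \<in> {a..b}"
    and "\<psi> s \<le> l" "h \<le> \<psi> t" "l \<le> h"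
  obtains c d where "{c..d} \<subseteq> {a..b}" "\<psi> ` {c..d} = {l..h}"
proof (cases "s \<le> t")
  case True
  then obtain c d where "s \<le> c" "c \<le> d" "d \<le> t" "\<psi> ` {c..d} = {l..h}"
    using crossing_subinterval_aux[of s t \<psi> l h] continuous_on_subset[OF cont, of "{s..t}"] assms by auto
  with that[of c d] st show ?thesis by auto
next
  case False
  have "continuous_on {-s..-t} (\<lambda>x. \<psi> (- x))"
    using st by (intro continuous_on_compose2[OF cont]) (auto intro: continuous_intros)
  then obtain c d where cd: "-s \<le> c" "c \<le> d" "d \<le> -t" "(\<lambda>x. \<psi> (- x)) ` {c..d} = {l..h}"
    using crossing_subinterval_aux[of "-s" "-t" "\<lambda>x. \<psi> (-x)" l h] assms False by auto
  have "\<psi> ` {-d..-c} = (\<lambda>x. \<psi> (- x)) ` {c..d}"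
    using image_image[of \<psi> uminus "{c..d}"] by simp
  with cd that[of "-d" "-c"] st show ?thesis by auto
qed

section \<open>Robust tracing\<close>

text \<open>
  The common form of shadowing and inverse shadowing: the family $H$ plays the role both of
  the iterates of a nearby map and of a method of class $T_S$.
\<close>
definition traces_robustly :: "('a::metric_space \<Rightarrow> 'a) \<Rightarrow> real \<Rightarrow> real \<Rightarrow> bool" where
  "traces_robustly g \<delta> \<epsilon> \<longleftrightarrow>
     (\<forall>s H. pseudo_orbit g \<delta> s \<and> (\<forall>y. H 0 y = y) \<and> (\<forall>n. continuous_on UNIV (H n)) \<and>
        (\<forall>y. pseudo_orbit g \<delta> (\<lambda>n. H n y)) \<longrightarrow>
        (\<exists>y. seq_shadows \<epsilon> (\<lambda>n. H n y) s))"

lemma traces_robustly_mono: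
  assumes "traces_robustly g \<delta> \<epsilon>" "\<epsilon> \<le> \<epsilon>'"
  shows "traces_robustly g \<delta> \<epsilon>'"
proof -
  have "seq_shadows \<epsilon> s t \<Longrightarrow> seq_shadows \<epsilon>' s t" for s t :: "nat \<Rightarrow> 'a"
    using \<open>\<epsilon> \<le> \<epsilon>'\<close> unfolding seq_shadows_def by (meson less_le_trans)
  then show ?thesis
    using assms(1) unfolding traces_robustly_def by blast
qed

text \<open>
  The idea is to keep a parameter interval on which $u_{k_n} \<circ> H_n \<circ> \<alpha>$ maps onto
  $[1/3,2/3]$.  It contains parameters at which $u_{k_{n+1}} \<circ> g \<circ> H_n \<circ> \<alpha>$ equals $0$ and $1$;
  since $H_{n+1}$ is close to $g \<circ> H_n$, the next coordinate still crosses the strip inside this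
  interval.  A parameter common to all these intervals gives the point.
\<close>
lemma realise_itinerary:
  fixes u :: "'v \<Rightarrow> 'a::metric_space \<Rightarrow> real" and H :: "nat \<Rightarrow> 'a \<Rightarrow> 'a"
  assumes cont_u: "\<And>v. v \<in> V \<Longrightarrow> continuous_on UNIV (u v)"
    and close_u: "\<And>v x y. v \<in> V \<Longrightarrow> dist x y < \<delta> \<Longrightarrow> \<bar>u v x - u v y\<bar> < 1/3"
    and cross: "\<And>v w. v \<in> V \<Longrightarrow> w \<in> S v \<Longrightarrow> \<exists>a\<in>{1/3..2/3}. \<exists>b\<in>{1/3..2/3::real}.
        \<forall>x. (u v x = a \<longrightarrow> u w (g x) = 0) \<and> (u v x = b \<longrightarrow> u w (g x) = 1)"
    and path: "\<And>v. v \<in> V \<Longrightarrow> \<exists>\<alpha>. path \<alpha> \<and> u v (\<alpha> 0) = 0 \<and> u v (\<alpha> 1) = 1"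
    and itinerary: "\<And>n. k n \<in> V" "\<And>n. k (Suc n) \<in> S (k n)"
    and H: "\<And>y. H 0 y = y" "\<And>n. continuous_on UNIV (H n)" "\<And>y. pseudo_orbit g \<delta> (\<lambda>n. H n y)"
  obtains y where "\<And>n. u (k n) (H n y) > 0"
proof -
  obtain \<alpha> where \<alpha>: "path \<alpha>" "u (k 0) (\<alpha> 0) = 0" "u (k 0) (\<alpha> 1) = 1"
    using path itinerary by blast
  define \<psi> where "\<psi> n t = u (k n) (H n (\<alpha> t))" for n t
  have cont\<psi>: "continuous_on {0..1} (\<psi> n)" for n
    unfolding \<psi>_def
    by (rule continuous_on_compose2[OF cont_u[OF itinerary(1)] continuous_on_compose2[OF H(2)]])
      (use \<alpha> in \<open>auto simp: path_def\<close>)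
  define good where "good n T \<longleftrightarrow> (\<exists>c d. T = {c..d}) \<and> T \<subseteq> {0..1} \<and> \<psi> n ` T = {1/3..2/3}" for n T
  have "\<exists>T. good 0 T"
  proof -
    obtain c d where "{c..d} \<subseteq> {0..1}" "\<psi> 0 ` {c..d} = {1/3..2/3}"
      by (rule crossing_subinterval[OF cont\<psi>[of 0], of 0 1 "1/3" "2/3"]) (auto simp: \<psi>_def H \<alpha>)
    then show ?thesis unfolding good_def by blast
  qed
  moreover have "\<exists>T'. good (Suc n) T' \<and> T' \<subseteq> T" if "good n T" for n T
  proof -
    obtain c d where cd: "T = {c..d}" "{c..d} \<subseteq> {0..1}" "\<psi> n ` {c..d} = {1/3..2/3}"
      using \<open>good n T\<close> unfolding good_def by blast
    obtain a b where ab: "a \<in> {1/3..2/3}" "b \<in> {1/3..2/3}"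
      and a: "\<And>x. u (k n) x = a \<Longrightarrow> u (k (Suc n)) (g x) = 0"
      and b: "\<And>x. u (k n) x = b \<Longrightarrow> u (k (Suc n)) (g x) = 1"
      using cross[OF itinerary(1)[of n] itinerary(2)[of n]] by blast
    obtain s t where st: "s \<in> {c..d}" "\<psi> n s = a" "t \<in> {c..d}" "\<psi> n t = b"
      using ab unfolding cd(3)[symmetric] by auto
    have near: "\<bar>u (k (Suc n)) (g (H n (\<alpha> x))) - \<psi> (Suc n) x\<bar> < 1/3" for x
      unfolding \<psi>_def using H(3)[of "\<alpha> x"] itinerary(1)[of "Suc n"]
      by (intro close_u) (auto simp: pseudo_orbit_def)
    have "\<psi> (Suc n) s \<le> 1/3" "2/3 \<le> \<psi> (Suc n) t"
      using near[of s] near[of t] a[of "H n (\<alpha> s)"] b[of "H n (\<alpha> t)"] st(2,4)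
      unfolding \<psi>_def abs_less_iff by linarith+
    then obtain c' d' where "{c'..d'} \<subseteq> {c..d}" "\<psi> (Suc n) ` {c'..d'} = {1/3..2/3}"
      using crossing_subinterval[of c d "\<psi> (Suc n)" s t "1/3" "2/3"]
        continuous_on_subset[OF cont\<psi> cd(2)] st by auto
    then show ?thesis using cd unfolding good_def by blast
  qed
  ultimately obtain T where T: "\<And>n. good n (T n)" "\<And>n. T (Suc n) \<subseteq> T n"
    using dependent_nat_choice[of good "\<lambda>n T T'. T' \<subseteq> T"] by metis
  have "T n \<noteq> {}" "compact (T n)" for n
    using T(1)[of n] by (auto simp: good_def)
  then have "\<Inter>(range T) \<noteq> {}"
    using T(2) by (intro compact_nest) (auto simp: lift_Suc_antimono_le)
  then obtain t where t: "\<And>n. t \<in> T n" by auto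
  have "u (k n) (H n (\<alpha> t)) > 0" for n
  proof -
    have "\<psi> n t \<in> {1/3..2/3}"
      using t[of n] T(1)[of n] unfolding good_def by blast
    then show ?thesis by (auto simp: \<psi>_def)
  qed
  then show ?thesis by (rule that)
qed

text \<open>
  Compactness makes the two hypotheses robust: $\<delta>$ is chosen so small that it changes no coordinate
  by $1/3$ and that the $\<delta>$-neighbourhood of $g(N_v)$ stays inside the union of the $N_w$,
  $w \<in> S(v)$.  The pseudo-orbit then has an itinerary that the covering relations allow, and that itinerary
  is realised.
\<close>
lemma covering_imp_traces_robustly:
  fixes u :: "'v \<Rightarrow> 'a::metric_space \<Rightarrow> real" and g :: "'a \<Rightarrow> 'a"
  assumes compact: "compact (UNIV :: 'a set)" and fin: "finite V"
    and cont_g: "continuous_on UNIV g"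
    and N: "\<And>v. v \<in> V \<Longrightarrow> closed (N v)" "\<And>x. \<exists>v\<in>V. x \<in> N v"
      "\<And>v x y. v \<in> V \<Longrightarrow> x \<in> N v \<Longrightarrow> y \<in> N v \<Longrightarrow> dist x y < \<epsilon>"
    and cont_u: "\<And>v. v \<in> V \<Longrightarrow> continuous_on UNIV (u v)"
    and supp_u: "\<And>v x. v \<in> V \<Longrightarrow> u v x > 0 \<Longrightarrow> x \<in> N v"
    and S: "\<And>v. v \<in> V \<Longrightarrow> S v \<subseteq> V" "\<And>v. v \<in> V \<Longrightarrow> g ` N v \<subseteq> interior (\<Union>w\<in>S v. N w)"
    and cross: "\<And>v w. v \<in> V \<Longrightarrow> w \<in> S v \<Longrightarrow> \<exists>a\<in>{1/3..2/3}. \<exists>b\<in>{1/3..2/3::real}.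
        \<forall>x. (u v x = a \<longrightarrow> u w (g x) = 0) \<and> (u v x = b \<longrightarrow> u w (g x) = 1)"
    and path: "\<And>v. v \<in> V \<Longrightarrow> \<exists>\<alpha>. path \<alpha> \<and> u v (\<alpha> 0) = 0 \<and> u v (\<alpha> 1) = 1"
  shows "\<exists>\<delta>>0. traces_robustly g \<delta> \<epsilon>"
proof -
  have "\<exists>\<delta>>0. (\<forall>x y. dist x y < \<delta> \<longrightarrow> \<bar>u v x - u v y\<bar> < 1/3) \<and>
      (\<forall>x y. x \<in> N v \<longrightarrow> dist (g x) y < \<delta> \<longrightarrow> y \<in> (\<Union>w\<in>S v. N w))" if v: "v \<in> V" for v
  proof -
    have "uniformly_continuous_on UNIV (u v)"
      using compact_uniformly_continuous[OF cont_u[OF v] compact] .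
    then obtain \<delta>1 where \<delta>1: "\<delta>1 > 0" "\<And>x y. dist x y < \<delta>1 \<Longrightarrow> \<bar>u v x - u v y\<bar> < 1/3"
      unfolding uniformly_continuous_on_def dist_real_def
      by (metis UNIV_I zero_less_divide_1_iff zero_less_numeral dist_commute)
    have "compact (g ` N v)"
      using N(1)[OF v] compact cont_g by (metis compact_Int_closed compact_continuous_image continuous_on_subset inf_top_left top_greatest)
    then obtain \<delta>2 where \<delta>2: "\<delta>2 > 0" "(\<Union>x\<in>g ` N v. ball x \<delta>2) \<subseteq> interior (\<Union>w\<in>S v. N w)"
      using compact_subset_open_imp_ball_epsilon_subset[OF _ open_interior S(2)[OF v]] by blast
    have "y \<in> (\<Union>w\<in>S v. N w)" if "x \<in> N v" "dist (g x) y < \<delta>2" for x y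
    proof -
      have "y \<in> (\<Union>x\<in>g ` N v. ball x \<delta>2)" using that by auto
      then show ?thesis using \<delta>2(2) interior_subset by blast
    qed
    with \<delta>1 \<delta>2(1) show ?thesis
      by (intro exI[of _ "min \<delta>1 \<delta>2"]) auto
  qed
  then obtain D where D: "\<And>v. v \<in> V \<Longrightarrow> D v > 0"
      "\<And>v x y. v \<in> V \<Longrightarrow> dist x y < D v \<Longrightarrow> \<bar>u v x - u v y\<bar> < 1/3"
      "\<And>v x y. v \<in> V \<Longrightarrow> x \<in> N v \<Longrightarrow> dist (g x) y < D v \<Longrightarrow> y \<in> (\<Union>w\<in>S v. N w)"
    by metis
  have "V \<noteq> {}" using N(2) by blast
  define \<delta> where "\<delta> = Min (D ` V)"
  have "\<delta> > 0" unfolding \<delta>_def using fin \<open>V \<noteq> {}\<close> D(1) by simp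
  have \<delta>_le: "\<delta> \<le> D v" if "v \<in> V" for v
    unfolding \<delta>_def using fin that by simp
  have "traces_robustly g \<delta> \<epsilon>"
    unfolding traces_robustly_def
  proof (intro allI impI, elim conjE)
    fix s and H :: "nat \<Rightarrow> 'a \<Rightarrow> 'a"
    assume s: "pseudo_orbit g \<delta> s" and H: "\<forall>y. H 0 y = y" "\<forall>n. continuous_on UNIV (H n)"
      "\<forall>y. pseudo_orbit g \<delta> (\<lambda>n. H n y)"
    have step: "\<exists>w. (w \<in> V \<and> s (Suc n) \<in> N w) \<and> w \<in> S v" if v: "v \<in> V \<and> s n \<in> N v" for v n
    proof -
      have "dist (g (s n)) (s (Suc n)) < D v"
        using s \<delta>_le[of v] v unfolding pseudo_orbit_def by (meson less_le_trans)
      then show ?thesis using D(3)[of v "s n" "s (Suc n)"] S(1)[of v] v by auto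
    qed
    have "\<exists>v. v \<in> V \<and> s 0 \<in> N v" using N(2)[of "s 0"] by auto
    from dependent_nat_choice[of "\<lambda>n v. v \<in> V \<and> s n \<in> N v" "\<lambda>n v w. w \<in> S v", OF this step]
    obtain k where k: "\<And>n. k n \<in> V" "\<And>n. s n \<in> N (k n)" "\<And>n. k (Suc n) \<in> S (k n)"
      by blast
    have close_u: "\<bar>u v x - u v y\<bar> < 1/3" if "v \<in> V" "dist x y < \<delta>" for v x y
      using D(2) \<delta>_le that by fastforce
    obtain y where y: "\<And>n. u (k n) (H n y) > 0"
      by (rule realise_itinerary[of V u \<delta> S g k H, OF cont_u close_u cross path k(1) k(3)]) (use H in auto)
    have "dist (H n y) (s n) < \<epsilon>" for n
      using N(3)[OF k(1) supp_u[OF k(1) y] k(2)] .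
    then show "\<exists>y. seq_shadows \<epsilon> (\<lambda>n. H n y) s"
      unfolding seq_shadows_def by blast
  qed
  with \<open>\<delta> > 0\<close> show ?thesis by blast
qed

section \<open>From robust tracing to generic bi-shadowing\<close>

lemma pseudo_orbit_perturb:
  assumes "pseudo_orbit h (\<delta> / 2) s" "\<And>x. dist (g x) (h x) < \<delta> / 2"
  shows "pseudo_orbit g \<delta> s"
  unfolding pseudo_orbit_def
proof
  fix i
  have "dist (g (s i)) (s (Suc i)) \<le> dist (g (s i)) (h (s i)) + dist (h (s i)) (s (Suc i))"
    by (rule dist_triangle)
  also have "\<dots> < \<delta> / 2 + \<delta> / 2"
    using assms unfolding pseudo_orbit_def by (intro add_strict_mono) auto
  finally show "dist (g (s i)) (s (Suc i)) < \<delta>" by simp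
qed

lemma pseudo_orbit_orbit_seq: "\<delta> > 0 \<Longrightarrow> pseudo_orbit h \<delta> (orbit_seq h x)"
  by (simp add: pseudo_orbit_def orbit_seq_def)

text \<open>
  The $n$-th coordinate is the composite $\<psi>_{n-1} \<circ> \<dots> \<circ> \<psi>_0$ of continuous maps.
\<close>
lemma continuous_on_T_S_component:
  assumes "delta_method h \<delta> \<xi>" "\<xi> \<in> T_S"
  shows "continuous_on UNIV (\<lambda>y. \<xi> y n)"
proof (induction n)
  case 0
  then show ?case using assms by (simp add: delta_method_def)
next
  case (Suc n)
  obtain \<psi> where "\<And>n. continuous_on UNIV (\<psi> n)" "\<And>n y. \<psi> n (\<xi> y n) = \<xi> y (Suc n)"
    using assms(2) unfolding T_S_def by blast
  then show ?case
    using continuous_on_compose2[OF _ Suc, of UNIV "\<psi> n"] by simp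
qed

lemma traces_robustly_imp_shadows:
  assumes tr: "traces_robustly g \<delta> \<epsilon>" and "\<delta> > 0" and near: "\<And>x. dist (g x) (h x) < \<delta> / 2"
    and cont_h: "continuous_on UNIV h"
  shows "pseudo_orbit h (\<delta> / 2) s \<Longrightarrow> \<exists>z. seq_shadows \<epsilon> (orbit_seq h z) s"
    and "delta_method h (\<delta> / 2) \<xi> \<Longrightarrow> \<xi> \<in> T_S \<Longrightarrow> \<exists>y. seq_shadows \<epsilon> (\<xi> y) (orbit_seq h x)"
proof -
  have trace: "\<exists>y. seq_shadows \<epsilon> (\<lambda>n. H n y) s"
    if "pseudo_orbit h (\<delta> / 2) s" "\<And>y. H 0 y = y" "\<And>n. continuous_on UNIV (H n)"
      "\<And>y. pseudo_orbit h (\<delta> / 2) (\<lambda>n. H n y)" for s H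
    using tr pseudo_orbit_perturb[OF that(1), of g] pseudo_orbit_perturb[OF that(4), of g] near that(2,3)
    unfolding traces_robustly_def by simp
  have po: "pseudo_orbit h (\<delta> / 2) (orbit_seq h x)" for x
    using \<open>\<delta> > 0\<close> by (simp add: pseudo_orbit_orbit_seq)
  show "\<exists>z. seq_shadows \<epsilon> (orbit_seq h z) s" if "pseudo_orbit h (\<delta> / 2) s"
  proof -
    have "continuous_on UNIV (h ^^ n)" for n
    proof (induction n)
      case (Suc n)
      then show ?case using continuous_on_compose2[OF cont_h Suc] by (simp add: o_def)
    qed (simp add: continuous_on_id')
    then have "\<exists>y. seq_shadows \<epsilon> (\<lambda>n. (h ^^ n) y) s"
      using po by (intro trace[OF that]) (auto simp: orbit_seq_def)
    then show ?thesis by (simp add: orbit_seq_def)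
  qed
  show "\<exists>y. seq_shadows \<epsilon> (\<xi> y) (orbit_seq h x)" if "delta_method h (\<delta> / 2) \<xi>" "\<xi> \<in> T_S"
    using trace[OF po, of "\<lambda>n y. \<xi> y n"] continuous_on_T_S_component[OF that] that(1)
    by (auto simp: delta_method_def)
qed

text \<open>
  For a compact metric space completeness is a property of the set \<open>UNIV\<close> and not a
  type class, hence this relativised form of the completeness of spaces of bounded continuous functions.
\<close>
lemma complete_bcontfun:
  assumes "complete (UNIV :: 'b::metric_space set)"
  shows "complete (UNIV :: ('a::metric_space \<Rightarrow>\<^sub>C 'b) set)"
  unfolding complete_def
proof (intro allI impI, elim conjE)
  fix f :: "nat \<Rightarrow> ('a \<Rightarrow>\<^sub>C 'b)"
  assume "Cauchy f"
  have unif: "\<exists>M. \<forall>m\<ge>M. \<forall>n\<ge>M. \<forall>x. dist (f m x) (f n x) < e" if "e > 0" for e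
    using \<open>Cauchy f\<close> that unfolding Cauchy_def by (metis dist_fun_lt_imp_dist_val_lt)
  have "Cauchy (\<lambda>n. f n x)" for x
    unfolding Cauchy_def using unif by metis
  then have "\<exists>l. (\<lambda>n. f n x) \<longlonglongrightarrow> l" for x
    using assms unfolding complete_def by blast
  then obtain l where l: "\<And>x. (\<lambda>n. f n x) \<longlonglongrightarrow> l x"
    by metis
  have "uniform_limit UNIV f l sequentially"
    unfolding uniform_limit_sequentially_iff
  proof (intro allI impI)
    fix e :: real assume "e > 0"
    then obtain M where M: "\<And>m n x. m \<ge> M \<Longrightarrow> n \<ge> M \<Longrightarrow> dist (f m x) (f n x) < e / 2"
      using unif[of "e / 2"] by auto
    have "dist (f n x) (l x) \<le> e / 2" if "n \<ge> M" for n x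
    proof (rule Lim_dist_ubound[OF sequentially_bot l])
      show "\<forall>\<^sub>F m in sequentially. dist (f n x) (f m x) \<le> e / 2"
        unfolding eventually_sequentially using M[OF that] by (meson less_imp_le)
    qed
    moreover have "e / 2 < e" using \<open>e > 0\<close> by simp
    ultimately show "\<exists>N. \<forall>n\<ge>N. \<forall>x\<in>UNIV. dist (f n x) (l x) < e"
      by (meson le_less_trans)
  qed
  from uniform_limit_bcontfunE[OF this sequentially_bot]
  show "\<exists>l\<in>UNIV. f \<longlonglongrightarrow> l" by auto
qed

lemma generic_Inter_open_dense:
  assumes "complete (UNIV :: 'b::metric_space set)"
    and "\<And>n::nat. open (U n)" "\<And>n. closure (U n) = (UNIV :: 'b set)" "(\<Inter>n. U n) \<subseteq> S"
  shows "generic S"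
proof -
  have "Met_TC.mtopology closure_of \<Inter>(range U) = UNIV"
    using assms by (intro Met_TC.metric_Baire_category) auto
  then have "closure (\<Inter>n. U n) = UNIV" by simp
  moreover have "gdelta (\<Inter>n. U n)" using assms(2) by (rule gdelta.intros)
  ultimately show ?thesis unfolding generic_def using assms(4) by blast
qed

lemma generic_bi_shadowing_if_dense_robust_tracing:
  assumes compact: "compact (UNIV :: 'a::metric_space set)"
    and dense: "\<And>(f :: 'a \<Rightarrow> 'a) e. continuous_on UNIV f \<Longrightarrow> e > 0 \<Longrightarrow>
      \<exists>g. continuous_on UNIV g \<and> (\<forall>x. dist (f x) (g x) < e) \<and> (\<exists>\<delta>>0. traces_robustly g \<delta> e)"
  shows "generic {f :: 'a \<Rightarrow>\<^sub>C 'a. T_S_bi_shadowing (apply_bcontfun f)}"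
proof -
  \<comment> \<open>The ball has radius $\<delta>/2$ because half of the error budget $\<delta>$ is spent on replacing
    $g$ by a nearby map and half on the pseudo-orbits of that map.\<close>
  define U :: "nat \<Rightarrow> ('a \<Rightarrow>\<^sub>C 'a) set" where
    "U n = (\<Union>{ball g (\<delta> / 2) | g \<delta>. \<delta> > 0 \<and> traces_robustly (apply_bcontfun g) \<delta> (inverse (Suc n))})" for n
  show ?thesis
  proof (rule generic_Inter_open_dense[of U])
    show "complete (UNIV :: ('a \<Rightarrow>\<^sub>C 'a) set)"
      using compact by (intro complete_bcontfun compact_imp_complete)
    show "open (U n)" for n
      unfolding U_def by auto
    show "closure (U n) = UNIV" for n
    proof -
      have "\<exists>g\<in>U n. dist g f < e" if "e > 0" for f e
      proof -
        define e' where "e' = min (e / 2) (inverse (Suc n))"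
        have "e' > 0" using \<open>e > 0\<close> by (simp add: e'_def)
        then obtain g \<delta> where g: "continuous_on UNIV g" "\<And>x. dist (apply_bcontfun f x) (g x) < e'"
          "\<delta> > 0" "traces_robustly g \<delta> e'"
          using dense[of "apply_bcontfun f" e'] by auto
        have "g \<in> bcontfun"
          unfolding bcontfun_def using g(1) compact_imp_bounded[OF compact_continuous_image[OF g(1) compact]]
          by simp
        then obtain G where G: "g = apply_bcontfun G" by (rule bcontfunE)
        have "traces_robustly g \<delta> (inverse (Suc n))"
          using g(4) by (rule traces_robustly_mono) (simp add: e'_def)
        then have "ball G (\<delta> / 2) \<subseteq> U n"
          unfolding U_def G using \<open>\<delta> > 0\<close> by blast
        then have "G \<in> U n" using \<open>\<delta> > 0\<close> by auto
        moreover have "dist G f \<le> e'"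
          using g(2) by (intro dist_bound) (auto simp: G dist_commute intro: less_imp_le)
        then have "dist G f < e" using \<open>e > 0\<close> by (simp add: e'_def)
        ultimately show ?thesis by blast
      qed
      then show ?thesis by (auto simp: closure_approachable)
    qed
    show "(\<Inter>n. U n) \<subseteq> {f. T_S_bi_shadowing (apply_bcontfun f)}"
    proof clarify
      fix f assume f: "f \<in> (\<Inter>n. U n)"
      have *: "\<exists>\<delta>>0. (\<forall>s. pseudo_orbit f \<delta> s \<longrightarrow> (\<exists>z. seq_shadows \<epsilon> (orbit_seq f z) s)) \<and>
          (\<forall>\<xi>. delta_method f \<delta> \<xi> \<and> \<xi> \<in> T_S \<longrightarrow> (\<forall>x. \<exists>y. seq_shadows \<epsilon> (\<xi> y) (orbit_seq f x)))"
        if "\<epsilon> > 0" for \<epsilon>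
      proof -
        obtain n where n: "inverse (real (Suc n)) < \<epsilon>"
          using reals_Archimedean[OF \<open>\<epsilon> > 0\<close>] by auto
        have "f \<in> U n" using f by blast
        then obtain g \<delta> where g: "\<delta> > 0" "traces_robustly (apply_bcontfun g) \<delta> (inverse (Suc n))"
          and "f \<in> ball g (\<delta> / 2)"
          unfolding U_def by blast
        then have "dist g f < \<delta> / 2" by simp
        note shadows = traces_robustly_imp_shadows[OF g(2,1) dist_fun_lt_imp_dist_val_lt[OF this]
            continuous_on_apply_bcontfun]
        have weaken: "seq_shadows (inverse (Suc n)) s t \<Longrightarrow> seq_shadows \<epsilon> s t" for s t :: "nat \<Rightarrow> 'a"
          using n unfolding seq_shadows_def by (meson less_trans)
        have "\<exists>z. seq_shadows \<epsilon> (orbit_seq f z) s" if "pseudo_orbit f (\<delta> / 2) s" for s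
          using shadows(1)[OF that] weaken by blast
        moreover have "\<exists>y. seq_shadows \<epsilon> (\<xi> y) (orbit_seq f x)"
          if "delta_method f (\<delta> / 2) \<xi>" "\<xi> \<in> T_S" for \<xi> x
          using shadows(2)[OF that] weaken by blast
        moreover have "\<delta> / 2 > 0" using \<open>\<delta> > 0\<close> by simp
        ultimately show ?thesis by blast
      qed
      then show "T_S_bi_shadowing (apply_bcontfun f)"
        unfolding T_S_bi_shadowing_def shadowing_def T_S_inverse_shadowing_def by meson
    qed
  qed
qed

section \<open>Paths visiting finite sets\<close>

lemma path_connected_Un_meeting:
  assumes P: "path_connected P" and A: "\<And>A. A \<in> \<A> \<Longrightarrow> path_connected A" "\<And>A. A \<in> \<A> \<Longrightarrow> A \<inter> P \<noteq> {}"
  shows "path_connected (P \<union> \<Union>\<A>)"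
proof (cases "P = {}")
  case True
  then have "\<A> = {}" using A(2) by auto
  then show ?thesis using True by simp
next
  case False
  then obtain z where "z \<in> P" by blast
  have "path_connected (\<Union>A\<in>insert {} \<A>. P \<union> A)"
  proof (rule path_connected_UNION[where z = z])
    fix A assume "A \<in> insert {} \<A>"
    then show "path_connected (P \<union> A)"
      using P path_connected_Un[OF P A(1)[of A]] A(2)[of A] by (auto simp: Int_commute)
  qed (use \<open>z \<in> P\<close> in auto)
  moreover have "(\<Union>A\<in>insert {} \<A>. P \<union> A) = P \<union> \<Union>\<A>" by auto
  ultimately show ?thesis by simp
qed

lemma path_through_finite_set:
  assumes "path_connected P" "finite Z" "Z \<subseteq> P" "c \<in> P"
  shows "\<exists>p. path p \<and> path_image p \<subseteq> P \<and> pathstart p = c \<and> Z \<subseteq> path_image p"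
  using assms(2,3)
proof (induction Z)
  case empty
  then show ?case
    using \<open>c \<in> P\<close> by (intro exI[of _ "\<lambda>_. c"]) (auto simp: path_def path_image_def pathstart_def)
next
  case (insert z Z)
  then obtain p where p: "path p" "path_image p \<subseteq> P" "pathstart p = c" "Z \<subseteq> path_image p"
    by auto
  have "pathfinish p \<in> P" using p(2) pathfinish_in_path_image by blast
  then obtain q where q: "path q" "path_image q \<subseteq> P" "pathstart q = pathfinish p" "pathfinish q = z"
    using assms(1) insert.prems unfolding path_connected_def by blast
  have "path_image (p +++ q) = path_image p \<union> path_image q"
    using q(3) by (simp add: path_image_join)
  moreover have "z \<in> path_image q"
    using q(4) pathfinish_in_path_image by blast
  ultimately show ?case
    using p q by (intro exI[of _ "p +++ q"]) auto
qed

text \<open>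
  The visits are confined to parameters in $[1/3,2/3]$ because a trajectory is only known to cross that part
  of a coordinate.
\<close>
lemma path_through_finite_set_in_middle_third:
  assumes "path_connected P" "finite Z" "Z \<subseteq> P" "c \<in> P"
  shows "\<exists>p. continuous_on {0..1} p \<and> p ` {0..1} \<subseteq> P \<and> p 0 = c \<and> Z \<subseteq> p ` {1/3..2/3::real}"
proof -
  obtain q where q: "path q" "path_image q \<subseteq> P" "pathstart q = c" "Z \<subseteq> path_image q"
    using path_through_finite_set[OF assms] by blast
  define p where "p t = q (max 0 (min 1 (3 * t - 1)))" for t :: real
  have "continuous_on {0..1} p"
    unfolding p_def
    by (rule continuous_on_compose2[OF q(1)[unfolded path_def]]) (auto intro!: continuous_intros)
  moreover have "p ` {0..1} \<subseteq> P"
    using q(2) by (auto simp: p_def path_image_def)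
  moreover have "p 0 = c" using q(3) by (simp add: p_def pathstart_def)
  moreover have "Z \<subseteq> p ` {1/3..2/3}"
  proof
    fix z assume "z \<in> Z"
    then obtain s where s: "s \<in> {0..1}" "z = q s" using q(4) by (auto simp: path_image_def)
    moreover have "3 * ((1 + s) / 3) - 1 = s" by (simp add: field_simps)
    ultimately have "z = p ((1 + s) / 3)" by (simp add: p_def)
    then show "z \<in> p ` {1/3..2/3}" using s by (intro image_eqI[of _ _ "(1 + s) / 3"]) auto
  qed
  ultimately show ?thesis by blast
qed

section \<open>Graphs as glued edges\<close>

text \<open>
  A graph is kept as a finite family of parametrised arcs, over an arbitrary index type so that the
  edges of a subdivision can be indexed by pairs.
\<close>
locale edge_graph =
  fixes J :: "'j set" and \<gamma> :: "'j \<Rightarrow> real \<Rightarrow> 'a::metric_space"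
  assumes finite_edges: "finite J"
    and arc_edge: "\<And>j. j \<in> J \<Longrightarrow> arc (\<gamma> j)"
    and edges_meet: "\<And>j k s t. \<lbrakk>j \<in> J; k \<in> J; j \<noteq> k; s \<in> {0..1}; t \<in> {0..1}; \<gamma> j s = \<gamma> k t\<rbrakk>
      \<Longrightarrow> s \<in> {0, 1} \<and> t \<in> {0, 1}"
begin

definition points :: "'a set" where
  "points = (\<Union>j\<in>J. \<gamma> j ` {0..1})"

lemma pointsE:
  assumes "x \<in> points"
  obtains j t where "j \<in> J" "t \<in> {0..1}" "x = \<gamma> j t"
  using assms unfolding points_def by blast

lemma pointsI: "j \<in> J \<Longrightarrow> t \<in> {0..1} \<Longrightarrow> \<gamma> j t \<in> points"
  unfolding points_def by blast

lemma same_point: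
  assumes "j \<in> J" "k \<in> J" "s \<in> {0..1}" "t \<in> {0..1}" "\<gamma> j s = \<gamma> k t"
  shows "j = k \<and> s = t \<or> s \<in> {0, 1} \<and> t \<in> {0, 1}"
  using edges_meet[of j k s t] arc_edge[of j] assms unfolding arc_def inj_on_def by blast

lemma continuous_edge: "j \<in> J \<Longrightarrow> continuous_on {0..1} (\<gamma> j)"
  using arc_edge by (auto simp: arc_def path_def)

lemma subedge:
  assumes "j \<in> J" "{a..b} \<subseteq> {0..1}"
  shows "compact (\<gamma> j ` {a..b})" "path_connected (\<gamma> j ` {a..b})"
proof -
  have "continuous_on {a..b} (\<gamma> j)" using continuous_edge[OF assms(1)] assms(2) continuous_on_subset by blast
  then show "compact (\<gamma> j ` {a..b})" "path_connected (\<gamma> j ` {a..b})"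
    by (auto intro: compact_continuous_image path_connected_continuous_image convex_imp_path_connected)
qed

text \<open>
  A family of maps on the edges that agree at the vertices (their common values there are given by $d$)
  defines a continuous map, because a finite closed cover determines continuity and every edge is
  homeomorphic to the interval.
\<close>
lemma glue:
  fixes c :: "'j \<Rightarrow> real \<Rightarrow> 'b::topological_space"
  assumes cont: "\<And>j. j \<in> J \<Longrightarrow> continuous_on {0..1} (c j)"
    and ends: "\<And>j. j \<in> J \<Longrightarrow> c j 0 = d (\<gamma> j 0)" "\<And>j. j \<in> J \<Longrightarrow> c j 1 = d (\<gamma> j 1)"
  obtains h where "continuous_on points h" "\<And>j t. j \<in> J \<Longrightarrow> t \<in> {0..1} \<Longrightarrow> h (\<gamma> j t) = c j t"
proof -
  have consistent: "c j s = c k t"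
    if "j \<in> J" "k \<in> J" "s \<in> {0..1}" "t \<in> {0..1}" "\<gamma> j s = \<gamma> k t" for j k s t
    using same_point[OF that] ends[OF that(1)] ends[OF that(2)] that(5) by auto
  have "\<exists>y. \<forall>j\<in>J. \<forall>t\<in>{0..1}. \<gamma> j t = x \<longrightarrow> c j t = y" for x
  proof (cases "x \<in> points")
    case True
    then obtain j t where "j \<in> J" "t \<in> {0..1}" "x = \<gamma> j t" by (rule pointsE)
    then show ?thesis using consistent by (intro exI[of _ "c j t"]) metis
  next
    case False
    then show ?thesis using pointsI by blast
  qed
  then obtain h where h: "\<And>x j t. j \<in> J \<Longrightarrow> t \<in> {0..1} \<Longrightarrow> \<gamma> j t = x \<Longrightarrow> c j t = h x"
    by metis
  have "continuous_on (\<gamma> j ` {0..1}) h" if j: "j \<in> J" for j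
  proof -
    obtain i where i: "homeomorphism {0..1} (path_image (\<gamma> j)) (\<gamma> j) i"
      using homeomorphism_arc[OF arc_edge[OF j]] .
    have "continuous_on (path_image (\<gamma> j)) (\<lambda>x. c j (i x))"
      using i by (intro continuous_on_compose2[OF cont[OF j]]) (auto simp: homeomorphism_def)
    moreover have "h x = c j (i x)" if "x \<in> path_image (\<gamma> j)" for x
    proof -
      have "i x \<in> {0..1}" "\<gamma> j (i x) = x" using i that unfolding homeomorphism_def by blast+
      then show ?thesis using h[OF j] by simp
    qed
    ultimately show ?thesis
      unfolding path_image_def by (metis (no_types, lifting) continuous_on_cong)
  qed
  then have "continuous_on points h"
    unfolding points_def using finite_edges subedge(1)[of _ 0 1]
    by (intro continuous_on_closed_Union) (auto intro: compact_imp_closed)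
  with that h show ?thesis by metis
qed

text \<open>
  The cores and the stars of vertices form a finite closed cover in which two distinct members meet
  only if one is the core of an edge and the other the star of one of its end points.
\<close>
definition core :: "'j \<Rightarrow> 'a set" where
  "core j = \<gamma> j ` {1/3..2/3}"

definition star :: "'a \<Rightarrow> 'a set" where
  "star p = {\<gamma> j t | j t. j \<in> J \<and> t \<in> {0..1} \<and> (t \<le> 1/3 \<and> \<gamma> j 0 = p \<or> 2/3 \<le> t \<and> \<gamma> j 1 = p)}"

lemma in_core_iff:
  assumes "j \<in> J" "k \<in> J" "t \<in> {0..1}"
  shows "\<gamma> j t \<in> core k \<longleftrightarrow> j = k \<and> t \<in> {1/3..2/3}"
proof
  assume "\<gamma> j t \<in> core k"
  then obtain s where s: "s \<in> {1/3..2/3}" "\<gamma> j t = \<gamma> k s" by (auto simp: core_def)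
  then show "j = k \<and> t \<in> {1/3..2/3}" using same_point[of j k t s] assms by auto
qed (auto simp: core_def)

lemma in_star_iff:
  assumes "j \<in> J" "t \<in> {0..1}"
  shows "\<gamma> j t \<in> star p \<longleftrightarrow> t \<le> 1/3 \<and> \<gamma> j 0 = p \<or> 2/3 \<le> t \<and> \<gamma> j 1 = p"
proof
  assume "\<gamma> j t \<in> star p"
  then obtain k s where "k \<in> J" "s \<in> {0..1}" "\<gamma> j t = \<gamma> k s"
    "s \<le> 1/3 \<and> \<gamma> k 0 = p \<or> 2/3 \<le> s \<and> \<gamma> k 1 = p" by (auto simp: star_def)
  then show "t \<le> 1/3 \<and> \<gamma> j 0 = p \<or> 2/3 \<le> t \<and> \<gamma> j 1 = p"
    using same_point[of j k t s] assms by auto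
qed (use assms in \<open>auto simp: star_def\<close>)

lemma core_subset: "j \<in> J \<Longrightarrow> core j \<subseteq> points"
  by (auto simp: core_def intro: pointsI)

lemma star_subset: "star p \<subseteq> points"
  by (auto simp: star_def intro: pointsI)

lemma disjoint_cores: "j \<in> J \<Longrightarrow> k \<in> J \<Longrightarrow> core j \<inter> core k \<noteq> {} \<Longrightarrow> j = k"
  using in_core_iff[of j k] by (fastforce simp: core_def[of j])

lemma disjoint_stars: "star p \<inter> star q \<noteq> {} \<Longrightarrow> p = q"
proof -
  assume "star p \<inter> star q \<noteq> {}"
  then obtain x where x: "x \<in> star p" "x \<in> star q" by blast
  then obtain j t where "j \<in> J" "t \<in> {0..1}" "x = \<gamma> j t" using star_subset pointsE by blast
  then show "p = q" using x in_star_iff[of j t] by auto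
qed

lemma star_meets_core: "j \<in> J \<Longrightarrow> star p \<inter> core j \<noteq> {} \<longleftrightarrow> p \<in> {\<gamma> j 0, \<gamma> j 1}"
proof
  assume j: "j \<in> J" and "star p \<inter> core j \<noteq> {}"
  then obtain t where "t \<in> {1/3..2/3}" "\<gamma> j t \<in> star p" unfolding core_def by blast
  then show "p \<in> {\<gamma> j 0, \<gamma> j 1}" using in_star_iff[OF j, of t p] by auto
next
  assume j: "j \<in> J" and "p \<in> {\<gamma> j 0, \<gamma> j 1}"
  then have "\<gamma> j (1/3) \<in> star p \<or> \<gamma> j (2/3) \<in> star p" by (auto simp: in_star_iff)
  moreover have "\<gamma> j (1/3) \<in> core j" "\<gamma> j (2/3) \<in> core j" by (auto simp: core_def)
  ultimately show "star p \<inter> core j \<noteq> {}" by blast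
qed

lemma compact_core: "j \<in> J \<Longrightarrow> compact (core j)"
  and path_connected_core: "j \<in> J \<Longrightarrow> path_connected (core j)"
  unfolding core_def by (auto intro: subedge)

lemma compact_star: "compact (star p)" and path_connected_star: "path_connected (star p)"
proof -
  define I where "I = (\<lambda>j. (j, {0..1/3::real})) ` {j \<in> J. \<gamma> j 0 = p} \<union> (\<lambda>j. (j, {2/3..1})) ` {j \<in> J. \<gamma> j 1 = p}"
  have star: "star p = (\<Union>i\<in>I. \<gamma> (fst i) ` snd i)"
    unfolding I_def star_def by fastforce
  have "finite I" unfolding I_def using finite_edges by auto
  have "compact (\<gamma> (fst i) ` snd i)" "path_connected (\<gamma> (fst i) ` snd i)" "p \<in> \<gamma> (fst i) ` snd i" if "i \<in> I" for i
    using that unfolding I_def by (auto intro!: subedge)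
  then show "compact (star p)" "path_connected (star p)"
    unfolding star using \<open>finite I\<close> by (auto intro!: compact_UN path_connected_UNION)
qed

definition hood :: "'j \<Rightarrow> 'a set" where
  "hood j = star (\<gamma> j 0) \<union> core j \<union> star (\<gamma> j 1)"

text \<open>
  The closed star of $j$ contains the hood of $j$ and, unlike the hood, consists of whole edges, so it
  is mapped into itself when edges are reparametrised.
\<close>
definition closed_star :: "'j \<Rightarrow> 'a set" where
  "closed_star j = \<gamma> j ` {0..1} \<union> \<Union>{\<gamma> k ` {0..1} | k. k \<in> J \<and> \<gamma> k ` {0..1} \<inter> \<gamma> j ` {0..1} \<noteq> {}}"

lemma closed_starI:
  "k \<in> J \<Longrightarrow> \<gamma> k ` {0..1} \<inter> \<gamma> j ` {0..1} \<noteq> {} \<Longrightarrow> t \<in> {0..1} \<Longrightarrow> \<gamma> k t \<in> closed_star j"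
  unfolding closed_star_def by blast

lemma path_connected_closed_star: "j \<in> J \<Longrightarrow> path_connected (closed_star j)"
  unfolding closed_star_def by (rule path_connected_Un_meeting) (auto intro: subedge)

lemma closed_star_subset: "j \<in> J \<Longrightarrow> closed_star j \<subseteq> points"
  unfolding closed_star_def by (auto intro: pointsI)

end

section \<open>Folding a map over the middle thirds\<close>

text \<open>
  \<open>collapse\<close> squeezes $[1/3,2/3]$ to the point $1/2$ and stretches the outer thirds; this
  frees the middle third for an excursion.  \<open>bump\<close> runs up and down once over the middle
  third, so an excursion along $\<beta>$ is traversed there and back and a
  single real coordinate, vanishing off the core, determines the value of the folded map.
\<close>
definition collapse :: "real \<Rightarrow> real" where
  "collapse t = min (1/2) (3 * t / 2) + max 0 (3 * t / 2 - 1)"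

definition bump :: "real \<Rightarrow> real" where
  "bump t = max 0 (1 - 6 * \<bar>t - 1/2\<bar>)"

lemma collapse_simps:
  "collapse 0 = 0" "collapse 1 = 1" "1/3 \<le> t \<Longrightarrow> t \<le> 2/3 \<Longrightarrow> collapse t = 1/2"
  "t \<in> {0..1} \<Longrightarrow> collapse t \<in> {0..1}"
  by (auto simp: collapse_def min_def max_def)

lemma bump_simps:
  "t \<le> 1/3 \<Longrightarrow> bump t = 0" "2/3 \<le> t \<Longrightarrow> bump t = 0" "bump (1/2) = 1" "bump t \<in> {0..1}"
  by (auto simp: bump_def max_def abs_if)

lemma continuous_collapse: "continuous_on A collapse" and continuous_bump: "continuous_on A bump"
  unfolding collapse_def bump_def by (auto intro!: continuous_intros)

context edge_graph
begin

text \<open>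
  $F$ reparametrised by \<open>collapse\<close> is constant on each core, so any path $\<beta>_j$ that starts at
  that constant can be inserted there.
\<close>
lemma folded_map:
  fixes F :: "'a \<Rightarrow> 'b::topological_space"
  assumes F: "continuous_on points F"
    and \<beta>: "\<And>j. j \<in> J \<Longrightarrow> continuous_on {0..1} (\<beta> j)" "\<And>j. j \<in> J \<Longrightarrow> \<beta> j 0 = F (\<gamma> j (1/2))"
  obtains h where "continuous_on points h"
    "\<And>j t. j \<in> J \<Longrightarrow> t \<in> {1/3..2/3} \<Longrightarrow> h (\<gamma> j t) = \<beta> j (bump t)"
    "\<And>j t. j \<in> J \<Longrightarrow> t \<in> {0..1/3} \<union> {2/3..1} \<Longrightarrow> h (\<gamma> j t) = F (\<gamma> j (collapse t))"
proof -
  define c where "c j t = (if t \<in> {1/3..2/3} then \<beta> j (bump t) else F (\<gamma> j (collapse t)))" for j t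
  have c_end: "c j t = F (\<gamma> j (collapse t))" if "j \<in> J" "t \<in> {0..1/3} \<union> {2/3..1}" for j t
    using that \<beta>(2)[OF that(1)] by (auto simp: c_def bump_simps collapse_simps)
  have "continuous_on {0..1} (c j)" if j: "j \<in> J" for j
  proof -
    have "continuous_on ({1/3..2/3} \<union> ({0..1/3} \<union> {2/3..1})) (c j)"
      unfolding c_def
    proof (rule continuous_on_If)
      show "continuous_on {1/3..2/3} (\<lambda>t. \<beta> j (bump t))"
        using bump_simps(4) by (intro continuous_on_compose2[OF \<beta>(1)[OF j] continuous_bump]) auto
      have "continuous_on {0..1} (\<lambda>t. F (\<gamma> j (collapse t)))"
      proof (rule continuous_on_compose2[OF F continuous_on_compose2[OF continuous_edge[OF j] continuous_collapse]])
        show "collapse ` {0..1} \<subseteq> {0..1}" using collapse_simps(4) by blast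
        then show "(\<lambda>t. \<gamma> j (collapse t)) ` {0..1} \<subseteq> points" using pointsI[OF j] by blast
      qed
      then show "continuous_on ({0..1/3} \<union> {2/3..1}) (\<lambda>t. F (\<gamma> j (collapse t)))"
        by (rule continuous_on_subset) auto
      show "\<beta> j (bump t) = F (\<gamma> j (collapse t))"
        if "t \<in> {0..1/3} \<union> {2/3..1}" "t \<in> {1/3..2/3}" for t
        using c_end[OF j that(1)] that(2) by (simp add: c_def)
    qed auto
    moreover have "{1/3..2/3} \<union> ({0..1/3} \<union> {2/3..1}) = {0..1::real}" by auto
    ultimately show ?thesis by simp
  qed
  moreover have "c j 0 = F (\<gamma> j 0)" "c j 1 = F (\<gamma> j 1)" for j
    by (auto simp: c_def collapse_simps)
  ultimately obtain h where h: "continuous_on points h" "\<And>j t. j \<in> J \<Longrightarrow> t \<in> {0..1} \<Longrightarrow> h (\<gamma> j t) = c j t"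
    using glue[of c F] by metis
  show ?thesis
  proof (rule that[OF h(1)])
    show "h (\<gamma> j t) = \<beta> j (bump t)" if "j \<in> J" "t \<in> {1/3..2/3}" for j t
      using h(2)[OF that(1), of t] that(2) by (simp add: c_def)
    show "h (\<gamma> j t) = F (\<gamma> j (collapse t))" if "j \<in> J" "t \<in> {0..1/3} \<union> {2/3..1}" for j t
      using h(2)[OF that(1), of t] c_end[OF that] that(2) by auto
  qed
qed

lemma edge_coordinate:
  assumes "k \<in> J"
  obtains h where "continuous_on points h"
    "\<And>j t. j \<in> J \<Longrightarrow> t \<in> {0..1} \<Longrightarrow> h (\<gamma> j t) = (if j = k then bump t else 0)"
proof (rule glue[of "\<lambda>j t. if j = k then bump t else 0" "\<lambda>_. 0"])
  show "continuous_on {0..1} (\<lambda>t. if j = k then bump t else 0)" for j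
    using continuous_bump by (cases "j = k") auto
qed (auto simp: bump_simps that)

lemma hood_cases:
  assumes "j \<in> J" "x \<in> hood j"
  obtains t where "t \<in> {1/3..2/3}" "x = \<gamma> j t"
  | k t where "k \<in> J" "t \<in> {0..1/3} \<union> {2/3..1}" "x = \<gamma> k t" "\<gamma> k ` {0..1} \<inter> \<gamma> j ` {0..1} \<noteq> {}"
proof (cases "x \<in> core j")
  case True
  then show ?thesis using that(1) by (auto simp: core_def)
next
  case False
  then obtain e where e: "e \<in> {0, 1}" "x \<in> star (\<gamma> j e)"
    using assms(2) unfolding hood_def by blast
  then obtain k t where kt: "k \<in> J" "t \<in> {0..1}" "x = \<gamma> k t"
    "t \<le> 1/3 \<and> \<gamma> k 0 = \<gamma> j e \<or> 2/3 \<le> t \<and> \<gamma> k 1 = \<gamma> j e"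
    unfolding star_def by blast
  have "\<gamma> j e \<in> {\<gamma> k 0, \<gamma> k 1}" using kt(4) by auto
  then have "\<gamma> j e \<in> \<gamma> k ` {0..1}" by auto
  moreover have "\<gamma> j e \<in> \<gamma> j ` {0..1}" using e by auto
  ultimately show ?thesis using kt by (intro that(2)[of k t]) auto
qed

lemma points_cover:
  assumes "x \<in> points"
  shows "\<exists>j\<in>J. x \<in> hood j"
proof -
  obtain j t where "j \<in> J" "t \<in> {0..1}" "x = \<gamma> j t" using assms by (rule pointsE)
  then have "x \<in> hood j" unfolding hood_def by (auto simp: in_star_iff in_core_iff)
  then show ?thesis using \<open>j \<in> J\<close> by blast
qed

text \<open>
  The image of the closed star of $j$ is enlarged in two rounds: first by the stars it meets, then
  by the cores that the result meets.  Two rounds suffice: a core touching the spread already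
  belongs to it, because distinct cores are disjoint, and a star touching it is adjacent to one of
  those cores.
\<close>
definition reach :: "('a \<Rightarrow> 'a) \<Rightarrow> 'j \<Rightarrow> 'a set" where
  "reach F j = F ` closed_star j \<union> \<Union>{star p | p. star p \<inter> F ` closed_star j \<noteq> {}}"

definition targets :: "('a \<Rightarrow> 'a) \<Rightarrow> 'j \<Rightarrow> 'j set" where
  "targets F j = {w \<in> J. core w \<inter> reach F j \<noteq> {}}"

definition spread :: "('a \<Rightarrow> 'a) \<Rightarrow> 'j \<Rightarrow> 'a set" where
  "spread F j = reach F j \<union> \<Union>(core ` targets F j)"

lemma path_connected_spread:
  assumes F: "continuous_on points F" and j: "j \<in> J"
  shows "path_connected (spread F j)"
proof -
  have "path_connected (F ` closed_star j)"
    using continuous_on_subset[OF F closed_star_subset[OF j]] path_connected_closed_star[OF j]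
    by (rule path_connected_continuous_image)
  then have "path_connected (reach F j)"
    unfolding reach_def by (rule path_connected_Un_meeting) (auto simp: path_connected_star)
  then show ?thesis
    unfolding spread_def by (rule path_connected_Un_meeting) (auto simp: targets_def path_connected_core)
qed

lemma spread_subset:
  assumes "F ` points \<subseteq> points" "j \<in> J"
  shows "spread F j \<subseteq> points"
proof -
  have "F ` closed_star j \<subseteq> points" using assms closed_star_subset by blast
  then show ?thesis
    unfolding spread_def reach_def targets_def using star_subset core_subset by blast
qed

text \<open>
  This is the closure property behind the two rounds: if all pieces (cores and stars) containing $x$ meet
  the spread of $j$, then $x$ is already in the hood of a target edge.  Points close to the spread
  satisfy the hypothesis because there are only finitely many pieces, all closed.
\<close>
lemma targets_absorb:
  assumes "x \<in> points" "\<And>k. k \<in> J \<Longrightarrow> x \<in> core k \<Longrightarrow> core k \<inter> spread F j \<noteq> {}"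
    "\<And>p. x \<in> star p \<Longrightarrow> star p \<inter> spread F j \<noteq> {}"
  shows "\<exists>w\<in>targets F j. x \<in> hood w"
proof -
  obtain k t where kt: "k \<in> J" "t \<in> {0..1}" "x = \<gamma> k t" using assms(1) by (rule pointsE)
  show ?thesis
  proof (cases "x \<in> core k")
    case True
    have "k \<in> targets F j"
    proof (cases "core k \<inter> reach F j = {}")
      case True
      then obtain w where w: "w \<in> targets F j" "core k \<inter> core w \<noteq> {}"
        using assms(2)[OF kt(1) \<open>x \<in> core k\<close>] unfolding spread_def by blast
      then show ?thesis using disjoint_cores[OF kt(1), of w] by (auto simp: targets_def)
    qed (auto simp: targets_def kt)
    then show ?thesis using True by (auto simp: hood_def)
  next
    case False
    then have "x \<in> star (\<gamma> k 0) \<or> x \<in> star (\<gamma> k 1)"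
      using kt by (auto simp: in_core_iff in_star_iff)
    then obtain e where e: "e \<in> {0, 1}" "x \<in> star (\<gamma> k e)"
      by blast
    have reached: ?thesis if "star (\<gamma> k e) \<subseteq> reach F j"
    proof -
      have "core k \<inter> star (\<gamma> k e) \<noteq> {}" using star_meets_core[OF kt(1), of "\<gamma> k e"] e(1) by auto
      then have "k \<in> targets F j" using that kt(1) unfolding targets_def by blast
      then show ?thesis using e unfolding hood_def by blast
    qed
    \<comment> \<open>The star may meet the spread in the image itself, in a star added in the first
      round (then it is that star), or in a core added in the second round (then it is adjacent
      to it).\<close>
    from assms(3)[OF e(2)] consider "star (\<gamma> k e) \<inter> F ` closed_star j \<noteq> {}"
      | q where "star q \<inter> F ` closed_star j \<noteq> {}" "star (\<gamma> k e) \<inter> star q \<noteq> {}"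
      | w where "w \<in> targets F j" "star (\<gamma> k e) \<inter> core w \<noteq> {}"
      unfolding spread_def reach_def by blast
    then show ?thesis
    proof cases
      case 1
      then show ?thesis by (intro reached) (auto simp: reach_def)
    next
      case 2
      then have "\<gamma> k e = q" by (intro disjoint_stars)
      with 2 show ?thesis by (intro reached) (auto simp: reach_def)
    next
      case 3
      then have "\<gamma> k e \<in> {\<gamma> w 0, \<gamma> w 1}" using star_meets_core[of w] by (auto simp: targets_def)
      then have "x \<in> hood w" using e(2) unfolding hood_def by auto
      then show ?thesis using 3 by blast
    qed
  qed
qed

end

section \<open>The perturbed map on a graph with short edges\<close>

locale short_edge_graph = edge_graph J \<gamma>
  for J :: "'j set" and \<gamma> :: "'j \<Rightarrow> real \<Rightarrow> 'a::metric_space" +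
  fixes \<mu> :: real
  assumes short: "\<And>j s t. j \<in> J \<Longrightarrow> s \<in> {0..1} \<Longrightarrow> t \<in> {0..1} \<Longrightarrow> dist (\<gamma> j s) (\<gamma> j t) < \<mu>"
begin

lemma dist_star: "x \<in> star p \<Longrightarrow> dist x p < \<mu>"
  unfolding star_def using short by fastforce

lemma dist_core: "j \<in> J \<Longrightarrow> x \<in> core j \<Longrightarrow> y \<in> core j \<Longrightarrow> dist x y < \<mu>"
  unfolding core_def using short by auto

lemma dist_hood:
  assumes j: "j \<in> J" and "x \<in> hood j"
  shows "dist x (\<gamma> j (1/2)) < 2 * \<mu>"
proof -
  have "\<mu> > 0" using short[OF j, of 0 0] by simp
  consider "x \<in> core j" | e where "e \<in> {0, 1}" "x \<in> star (\<gamma> j e)"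
    using assms(2) unfolding hood_def by blast
  then show ?thesis
  proof cases
    case 1
    then show ?thesis using dist_core[OF j 1, of "\<gamma> j (1/2)"] \<open>\<mu> > 0\<close> by (auto simp: core_def)
  next
    case 2
    then show ?thesis
      using dist_triangle[of x "\<gamma> j (1/2)" "\<gamma> j e"] dist_star[of x] short[OF j, of e "1/2"] by fastforce
  qed
qed

lemma dist_closed_star:
  assumes j: "j \<in> J" and "x \<in> closed_star j"
  shows "dist x (\<gamma> j (1/2)) < 2 * \<mu>"
proof -
  have "\<mu> > 0" using short[OF j, of 0 0] by simp
  obtain k a b t where k: "k \<in> J" "a \<in> {0..1}" "b \<in> {0..1}" "t \<in> {0..1}" "\<gamma> k a = \<gamma> j b" "x = \<gamma> k t"
  proof (cases "x \<in> \<gamma> j ` {0..1}")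
    case True
    then obtain t where "t \<in> {0..1}" "x = \<gamma> j t" by blast
    then show ?thesis using that[OF j, of 0 0 t] by simp
  next
    case False
    then obtain k where k: "k \<in> J" "\<gamma> k ` {0..1} \<inter> \<gamma> j ` {0..1} \<noteq> {}" "x \<in> \<gamma> k ` {0..1}"
      using assms(2) unfolding closed_star_def by blast
    from k(2) obtain z where z: "z \<in> \<gamma> k ` {0..1}" "z \<in> \<gamma> j ` {0..1}" by blast
    obtain a where a: "a \<in> {0..1}" "z = \<gamma> k a" using z(1) by (rule imageE)
    obtain b where b: "b \<in> {0..1}" "z = \<gamma> j b" using z(2) by (rule imageE)
    obtain t where t: "t \<in> {0..1}" "x = \<gamma> k t" using k(3) by (rule imageE)
    show ?thesis using that[OF k(1) a(1) b(1) t(1)] a(2) b(2) t(2) by simp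
  qed
  have "dist x (\<gamma> j (1/2)) \<le> dist (\<gamma> k t) (\<gamma> k a) + dist (\<gamma> j b) (\<gamma> j (1/2))"
    using dist_triangle[of x "\<gamma> j (1/2)" "\<gamma> k a"] k by simp
  also have "\<dots> < 2 * \<mu>"
    using short[OF k(1) k(4,2)] short[OF j k(3), of "1/2"] by simp
  finally show ?thesis .
qed

text \<open>
  Two rounds of enlargement by pieces of size at most $2\<mu>$ and $\<mu>$ cost $3\<mu>$.
\<close>
lemma dist_spread:
  assumes j: "j \<in> J" and F: "\<And>x y. x \<in> points \<Longrightarrow> y \<in> points \<Longrightarrow> dist x y < 2 * \<mu> \<Longrightarrow> dist (F x) (F y) < e"
    and "y \<in> spread F j"
  shows "dist y (F (\<gamma> j (1/2))) < 3 * \<mu> + e"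
proof -
  let ?c = "F (\<gamma> j (1/2))"
  have "\<mu> > 0" using short[OF j, of 0 0] by simp
  have image: "dist z ?c < e" if z: "z \<in> F ` closed_star j" for z
  proof -
    obtain x where "x \<in> closed_star j" "z = F x" using z by blast
    then show ?thesis using F[of x "\<gamma> j (1/2)"] dist_closed_star[OF j] closed_star_subset[OF j] pointsI[OF j, of "1/2"] by auto
  qed
  have reach: "dist z ?c < 2 * \<mu> + e" if z: "z \<in> reach F j" for z
  proof (cases "z \<in> F ` closed_star j")
    case True
    then show ?thesis using image[of z] \<open>\<mu> > 0\<close> by simp
  next
    case False
    then obtain p z' where "z \<in> star p" "z' \<in> star p" "z' \<in> F ` closed_star j"
      using z unfolding reach_def by blast
    then show ?thesis
      using dist_triangle[of z ?c z'] dist_triangle2[of z z' p] dist_star[of z p] dist_star[of z' p] image[of z'] by simp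
  qed
  show ?thesis
  proof (cases "y \<in> reach F j")
    case True
    then show ?thesis using reach[of y] \<open>\<mu> > 0\<close> by simp
  next
    case False
    then obtain w z where "w \<in> J" "y \<in> core w" "z \<in> core w" "z \<in> reach F j"
      using assms(3) unfolding spread_def targets_def by blast
    then show ?thesis
      using dist_triangle[of y ?c z] dist_core[of w y z] reach[of z] by simp
  qed
qed

text \<open>
  All maps and coordinates are pulled back along the retraction $r$, so that only the graph matters: the
  new map is $h \<circ> r$, where $h$ is $F$ folded along paths $\<beta>_j$ inside the spread of $j$.  Each
  $\<beta>_j$ visits, for every target edge $w$, the points with parameters $1/3$ and $1/2$, where the
  coordinate of $w$ is $0$ and $1$; this is the crossing condition.
\<close>
lemma robustly_tracing_map:
  fixes r F :: "'a \<Rightarrow> 'a"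
  assumes compact: "compact (UNIV :: 'a set)"
    and r: "retraction UNIV points r" "\<And>x. dist (r x) x < \<eta>"
    and F: "continuous_on points F" "F ` points \<subseteq> points"
    and modulus: "\<And>x y. x \<in> points \<Longrightarrow> y \<in> points \<Longrightarrow> dist x y < 2 * \<mu> \<Longrightarrow> dist (F x) (F y) < e"
  obtains g where "continuous_on UNIV g" "\<And>x. dist (g x) (F (r x)) < 3 * \<mu> + 2 * e"
    "\<exists>\<delta>>0. traces_robustly g \<delta> (4 * \<mu> + 2 * \<eta>)"
proof -
  have cont_r: "continuous_on UNIV r" and r_in: "\<And>x. r x \<in> points" and r_id: "\<And>x. x \<in> points \<Longrightarrow> r x = x"
    using r(1) unfolding retraction_def by auto
  let ?Q = "spread F" and ?S = "targets F"
  have targets_edges: "?S j \<subseteq> J" for j by (auto simp: targets_def)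
  have mid: "F (\<gamma> j (1/2)) \<in> ?Q j" if "j \<in> J" for j
    unfolding spread_def reach_def closed_star_def by auto
  define Z where "Z j = (\<lambda>w. \<gamma> w (1/3)) ` ?S j \<union> (\<lambda>w. \<gamma> w (1/2)) ` ?S j" for j
  have Z: "finite (Z j)" "Z j \<subseteq> ?Q j" for j
    using finite_subset[OF targets_edges finite_edges] unfolding Z_def spread_def core_def by auto
  have "\<forall>j\<in>J. \<exists>p. continuous_on {0..1} p \<and> p ` {0..1} \<subseteq> ?Q j \<and> p 0 = F (\<gamma> j (1/2)) \<and> Z j \<subseteq> p ` {1/3..2/3::real}"
    using path_through_finite_set_in_middle_third[OF path_connected_spread[OF F(1)] Z mid] by blast
  then obtain \<beta> where \<beta>: "\<And>j. j \<in> J \<Longrightarrow> continuous_on {0..1} (\<beta> j)" "\<And>j. j \<in> J \<Longrightarrow> \<beta> j ` {0..1} \<subseteq> ?Q j"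
    "\<And>j. j \<in> J \<Longrightarrow> \<beta> j 0 = F (\<gamma> j (1/2))" "\<And>j. j \<in> J \<Longrightarrow> Z j \<subseteq> \<beta> j ` {1/3..2/3::real}"
    unfolding bchoice_iff by blast
  obtain h where h: "continuous_on points h"
    "\<And>j t. j \<in> J \<Longrightarrow> t \<in> {1/3..2/3} \<Longrightarrow> h (\<gamma> j t) = \<beta> j (bump t)"
    "\<And>j t. j \<in> J \<Longrightarrow> t \<in> {0..1/3} \<union> {2/3..1} \<Longrightarrow> h (\<gamma> j t) = F (\<gamma> j (collapse t))"
    using folded_map[OF F(1) \<beta>(1,3)] by blast
  have "\<exists>v. continuous_on points v \<and> (\<forall>j\<in>J. \<forall>t\<in>{0..1}. v (\<gamma> j t) = (if j = k then bump t else 0))" if "k \<in> J" for k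
    using edge_coordinate[OF that] by metis
  then obtain v where v: "\<And>k. k \<in> J \<Longrightarrow> continuous_on points (v k)"
    "\<And>k j t. k \<in> J \<Longrightarrow> j \<in> J \<Longrightarrow> t \<in> {0..1} \<Longrightarrow> v k (\<gamma> j t) = (if j = k then bump t else 0)"
    by metis
  define g where "g x = h (r x)" for x
  define u where "u k x = v k (r x)" for k x
  define N where "N j = r -` hood j" for j
  have cont_g: "continuous_on UNIV g"
    unfolding g_def using r_in by (intro continuous_on_compose2[OF h(1) cont_r]) auto
  have near_F: "dist (g x) (F (r x)) < 3 * \<mu> + 2 * e" for x
  proof -
    obtain j t where jt: "j \<in> J" "t \<in> {0..1}" "r x = \<gamma> j t" using r_in pointsE by blast
    have "\<mu> > 0" using short[OF jt(1), of 0 0] by simp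
    have "dist (F (\<gamma> j s)) (F (\<gamma> j t)) < e" if "s \<in> {0..1}" for s
      using modulus[OF pointsI[OF jt(1) that] pointsI[OF jt(1,2)]] short[OF jt(1) that jt(2)] \<open>\<mu> > 0\<close> by simp
    note F_edge = this
    have "e > 0" using F_edge[OF jt(2)] by simp
    show ?thesis
    proof (cases "t \<in> {1/3..2/3}")
      case True
      have "g x \<in> ?Q j" using \<beta>(2)[OF jt(1)] bump_simps(4)[of t] h(2)[OF jt(1) True] jt(3) by (auto simp: g_def)
      then show ?thesis
        using dist_spread[OF jt(1), of F e "g x", OF modulus] F_edge[of "1/2"] jt(3)
          dist_triangle[of "g x" "F (r x)" "F (\<gamma> j (1/2))"] by auto
    next
      case False
      then have "g x = F (\<gamma> j (collapse t))" using h(3)[OF jt(1), of t] jt by (auto simp: g_def)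
      then show ?thesis using F_edge[OF collapse_simps(4)[OF jt(2)]] jt(3) \<open>\<mu> > 0\<close> \<open>e > 0\<close> by simp
    qed
  qed
  have g_into: "g x \<in> ?Q j" if j: "j \<in> J" and x: "x \<in> N j" for j x
  proof -
    have "r x \<in> hood j" using x by (simp add: N_def)
    with j show ?thesis
    proof (cases rule: hood_cases)
      case (1 t)
      then show ?thesis using \<beta>(2)[OF j] bump_simps(4)[of t] h(2)[OF j] by (auto simp: g_def)
    next
      case (2 k t)
      have "t \<in> {0..1}" using 2(2) by auto
      then have "\<gamma> k (collapse t) \<in> closed_star j"
        using 2(1,4) by (intro closed_starI collapse_simps(4))
      then show ?thesis using 2 h(3)[OF 2(1,2)] by (auto simp: g_def spread_def reach_def)
    qed
  qed
  have g_covers: "g ` N j \<subseteq> interior (\<Union>w\<in>?S j. N w)" if j: "j \<in> J" for j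
  proof -
    \<comment> \<open>Removing the finitely many pieces that miss the spread leaves an open set.\<close>
    define K where "K = core ` J \<union> star ` ((\<lambda>k. \<gamma> k 0) ` J \<union> (\<lambda>k. \<gamma> k 1) ` J)"
    define W where "W = \<Union>{A \<in> K. A \<inter> ?Q j = {}}"
    have "finite K" unfolding K_def using finite_edges by auto
    then have "closed W"
      unfolding W_def by (intro closed_Union) (auto simp: K_def intro: compact_imp_closed compact_core compact_star)
    then have "open (- (r -` W))" using closed_vimage[OF _ cont_r] by (simp add: open_Compl)
    moreover have "- (r -` W) \<subseteq> (\<Union>w\<in>?S j. N w)"
    proof
      fix x assume "x \<in> - (r -` W)"
      then have x: "A \<inter> ?Q j \<noteq> {}" if "A \<in> K" "r x \<in> A" for A using that by (auto simp: W_def)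
      have "\<exists>w\<in>?S j. r x \<in> hood w"
      proof (rule targets_absorb[OF r_in])
        show "core k \<inter> ?Q j \<noteq> {}" if "k \<in> J" "r x \<in> core k" for k
          using that by (intro x) (auto simp: K_def)
        show "star p \<inter> ?Q j \<noteq> {}" if "r x \<in> star p" for p
          using that by (intro x) (auto simp: K_def star_def)
      qed
      then show "x \<in> (\<Union>w\<in>?S j. N w)" by (simp add: N_def)
    qed
    moreover have "g ` N j \<subseteq> - (r -` W)"
    proof -
      have "r (g x) \<notin> W" if "x \<in> N j" for x
      proof -
        have "g x \<in> ?Q j" using g_into[OF j that] .
        moreover from this have "r (g x) = g x" using spread_subset[OF F(2) j] by (blast intro: r_id)
        ultimately show ?thesis unfolding W_def by auto
      qed
      then show ?thesis by auto
    qed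
    ultimately show ?thesis by (meson interior_maximal subset_trans)
  qed
  have "\<exists>\<delta>>0. traces_robustly g \<delta> (4 * \<mu> + 2 * \<eta>)"
  proof (rule covering_imp_traces_robustly[OF compact finite_edges cont_g, of N _ u ?S])
    fix j assume j: "j \<in> J"
    have "closed (hood j)"
      unfolding hood_def using compact_core[OF j] compact_star by (intro closed_Un) (auto intro: compact_imp_closed)
    then show "closed (N j)" unfolding N_def using cont_r by (rule closed_vimage)
    show "dist x y < 4 * \<mu> + 2 * \<eta>" if "x \<in> N j" "y \<in> N j" for x y
    proof -
      have "dist (r x) (r y) < 4 * \<mu>"
        using dist_hood[OF j, of "r x"] dist_hood[OF j, of "r y"] dist_triangle2[of "r x" "r y" "\<gamma> j (1/2)"] that
        by (simp add: N_def)
      moreover have "dist x y \<le> dist (r x) x + (dist (r x) (r y) + dist (r y) y)"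
        using dist_triangle3[of x y "r x"] dist_triangle[of "r x" y "r y"] by linarith
      ultimately show ?thesis using r(2)[of x] r(2)[of y] by linarith
    qed
    show "continuous_on UNIV (u j)"
      unfolding u_def using r_in by (intro continuous_on_compose2[OF v(1)[OF j] cont_r]) auto
    show "x \<in> N j" if "u j x > 0" for x
    proof -
      obtain k t where kt: "k \<in> J" "t \<in> {0..1}" "r x = \<gamma> k t" using r_in pointsE by blast
      then have "k = j" "bump t > 0" using that v(2)[OF j kt(1,2)] by (auto simp: u_def split: if_splits)
      then show ?thesis using kt bump_simps(1,2)[of t] by (force simp: N_def hood_def in_core_iff)
    qed
    show "?S j \<subseteq> J" by (rule targets_edges)
    show "g ` N j \<subseteq> interior (\<Union>w\<in>?S j. N w)" using j by (rule g_covers)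
    show "\<exists>\<alpha>. path \<alpha> \<and> u j (\<alpha> 0) = 0 \<and> u j (\<alpha> 1) = 1"
    proof (intro exI conjI)
      let ?\<alpha> = "\<lambda>t. \<gamma> j (1/3 + t/6)"
      show "path ?\<alpha>"
        unfolding path_def by (intro continuous_on_compose2[OF continuous_edge[OF j]]) (auto intro!: continuous_intros)
      show "u j (?\<alpha> 0) = 0" "u j (?\<alpha> 1) = 1"
        using v(2)[OF j j] by (auto simp: u_def r_id pointsI j bump_simps)
    qed
    fix w assume w: "w \<in> ?S j"
    then have wJ: "w \<in> J" using targets_edges by blast
    have "\<gamma> w (1/3) \<in> Z j" "\<gamma> w (1/2) \<in> Z j" using w by (auto simp: Z_def)
    then have in_image: "\<gamma> w (1/3) \<in> \<beta> j ` {1/3..2/3}" "\<gamma> w (1/2) \<in> \<beta> j ` {1/3..2/3}"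
      using \<beta>(4)[OF j] by blast+
    from in_image(1) obtain a where a: "\<gamma> w (1/3) = \<beta> j a" "a \<in> {1/3..2/3}" by (rule imageE)
    from in_image(2) obtain b where b: "\<gamma> w (1/2) = \<beta> j b" "b \<in> {1/3..2/3}" by (rule imageE)
    have folded: "g x = \<beta> j (u j x)" if "u j x > 0" for x
    proof -
      obtain k t where kt: "k \<in> J" "t \<in> {0..1}" "r x = \<gamma> k t" using r_in pointsE by blast
      then have "k = j" "u j x = bump t" "bump t > 0" using that v(2)[OF j kt(1,2)] by (auto simp: u_def split: if_splits)
      moreover from this have "t \<in> {1/3..2/3}" using bump_simps(1,2)[of t] by force
      ultimately show ?thesis using kt h(2)[OF j] by (simp add: g_def)
    qed
    have coordinate: "u w (\<gamma> w (1/3)) = 0" "u w (\<gamma> w (1/2)) = 1"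
      using v(2)[OF wJ wJ] by (auto simp: u_def r_id pointsI wJ bump_simps)
    show "\<exists>a\<in>{1/3..2/3}. \<exists>b\<in>{1/3..2/3::real}. \<forall>x. (u j x = a \<longrightarrow> u w (g x) = 0) \<and> (u j x = b \<longrightarrow> u w (g x) = 1)"
    proof (intro bexI[OF bexI[OF _ b(2)] a(2)] allI conjI impI)
      show "u w (g x) = 0" if "u j x = a" for x
        using folded[of x] that a coordinate by auto
      show "u w (g x) = 1" if "u j x = b" for x
        using folded[of x] that b coordinate by auto
    qed
  next
    show "\<exists>j\<in>J. x \<in> N j" for x using points_cover[OF r_in] by (simp add: N_def)
  qed
  with that cont_g near_F show ?thesis by blast
qed

end

section \<open>Subdividing a graph\<close>

lemma subdivided_edges_meet:
  fixes m i k :: nat and s t :: real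
  assumes "i < m" "s \<in> {0..1}" "(i + s) / m \<in> {0, 1}"
  shows "s \<in> {0, 1}"
proof -
  have "i + s = 0 \<or> i + s = m" using assms by (auto simp: field_simps)
  moreover have "real i + 1 \<le> m" using assms(1) by linarith
  ultimately show ?thesis using assms(2) by auto
qed

text \<open>
  The edge $(j,i)$ is the $i$-th of $m$ pieces of the $j$-th arc.  Pieces of different arcs meet only
  at end points of those arcs, which are also end points of the pieces.
\<close>
lemma graph_imp_short_edge_graph:
  assumes G: "graph G" and "\<mu> > 0"
  obtains J :: "(nat \<times> nat) set" and \<gamma> where "short_edge_graph J \<gamma> \<mu>" "edge_graph.points J \<gamma> = G"
proof -
  obtain n :: nat and \<gamma> where n: "\<And>j. j \<in> {1..n} \<Longrightarrow> arc (\<gamma> j)" "G = (\<Union>j\<in>{1..n}. path_image (\<gamma> j))"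
    "\<And>j k. j \<in> {1..n} \<Longrightarrow> k \<in> {1..n} \<Longrightarrow> j \<noteq> k \<Longrightarrow>
      path_image (\<gamma> j) \<inter> path_image (\<gamma> k) \<subseteq> {pathstart (\<gamma> j), pathfinish (\<gamma> j)}"
    using G unfolding graph_def by blast
  have inj: "s = t" if "j \<in> {1..n}" "s \<in> {0..1}" "t \<in> {0..1}" "\<gamma> j s = \<gamma> j t" for j s t
    using n(1)[OF that(1)] that by (auto simp: arc_def inj_on_def)
  have meet: "s \<in> {0, 1}" if "j \<in> {1..n}" "k \<in> {1..n}" "j \<noteq> k" "s \<in> {0..1}" "t \<in> {0..1}" "\<gamma> j s = \<gamma> k t" for j k s t
  proof -
    have "\<gamma> j s \<in> path_image (\<gamma> j) \<inter> path_image (\<gamma> k)"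
      using that unfolding path_image_def by (metis IntI imageI)
    then have "\<gamma> j s \<in> {\<gamma> j 0, \<gamma> j 1}"
      using n(3)[OF that(1-3)] by (auto simp: pathstart_def pathfinish_def)
    then show ?thesis using inj[OF that(1,4), of 0] inj[OF that(1,4), of 1] by auto
  qed
  have "\<exists>M. \<forall>m\<ge>M. \<forall>s\<in>{0..1}. \<forall>t\<in>{0..1}. \<bar>s - t\<bar> \<le> 1 / real (Suc m) \<longrightarrow> dist (\<gamma> j s) (\<gamma> j t) < \<mu>"
    if "j \<in> {1..n}" for j
  proof -
    have "uniformly_continuous_on {0..1} (\<gamma> j)"
      using n(1)[OF that] by (intro compact_uniformly_continuous) (auto simp: arc_def path_def)
    then obtain d where d: "d > 0" "\<And>s t. s \<in> {0..1} \<Longrightarrow> t \<in> {0..1} \<Longrightarrow> dist t s < d \<Longrightarrow> dist (\<gamma> j t) (\<gamma> j s) < \<mu>"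
      using \<open>\<mu> > 0\<close> unfolding uniformly_continuous_on_def by blast
    obtain M where M: "1 / real (Suc M) < d"
      using reals_Archimedean[OF d(1)] by (auto simp: inverse_eq_divide)
    have "1 / real (Suc m) < d" if "m \<ge> M" for m
      using M that by (intro le_less_trans[OF _ M] divide_left_mono) auto
    then show ?thesis using d(2) by (intro exI[of _ M]) (force simp: dist_real_def)
  qed
  then obtain M where M: "\<And>j m s t. j \<in> {1..n} \<Longrightarrow> m \<ge> M j \<Longrightarrow> s \<in> {0..1} \<Longrightarrow> t \<in> {0..1} \<Longrightarrow>
      \<bar>s - t\<bar> \<le> 1 / real (Suc m) \<Longrightarrow> dist (\<gamma> j s) (\<gamma> j t) < \<mu>"
    by metis
  define m where "m = Suc (Max (M ` {1..n}))"
  have "m > 0" by (simp add: m_def)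
  have fine: "dist (\<gamma> j s) (\<gamma> j t) < \<mu>" if "j \<in> {1..n}" "s \<in> {0..1}" "t \<in> {0..1}" "\<bar>s - t\<bar> \<le> 1 / m" for j s t
    using M[OF that(1) _ that(2,3), of "Max (M ` {1..n})"] that(1,4) by (simp add: m_def)
  define J where "J = {1..n} \<times> {..<m}"
  define \<delta> where "\<delta> = (\<lambda>(j, i) t. \<gamma> j ((real i + t) / m))"
  have param: "(real i + t) / m \<in> {0..1}" if "i < m" "t \<in> {0..1}" for i t
  proof -
    have "real i + 1 \<le> m" using that(1) by linarith
    then show ?thesis using that \<open>m > 0\<close> by (auto simp: field_simps)
  qed
  have short_graph: "short_edge_graph J \<delta> \<mu>"
  proof
    show "finite J" by (simp add: J_def)
    show "arc (\<delta> x)" if "x \<in> J" for x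
    proof -
      obtain j i where x: "x = (j, i)" "j \<in> {1..n}" "i < m" using \<open>x \<in> J\<close> unfolding J_def by blast
      have "continuous_on {0..1} (\<gamma> j)" using n(1)[OF x(2)] by (simp add: arc_def path_def)
      then have "continuous_on {0..1} (\<delta> x)"
        unfolding \<delta>_def x(1) prod.case
        by (rule continuous_on_compose2) (use param[OF x(3)] \<open>m > 0\<close> in \<open>auto intro!: continuous_intros\<close>)
      moreover have "inj_on (\<delta> x) {0..1}"
      proof (rule inj_onI)
        fix s t :: real assume st: "s \<in> {0..1}" "t \<in> {0..1}" "\<delta> x s = \<delta> x t"
        then have "(real i + s) / m = (real i + t) / m"
          using inj[OF x(2) param[OF x(3)] param[OF x(3)]] by (simp add: \<delta>_def x(1))
        then show "s = t" using \<open>m > 0\<close> by simp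
      qed
      ultimately show ?thesis by (simp add: arc_def path_def)
    qed
    show "s \<in> {0, 1} \<and> t \<in> {0, 1}"
      if "x \<in> J" "y \<in> J" "x \<noteq> y" "s \<in> {0..1}" "t \<in> {0..1}" "\<delta> x s = \<delta> y t" for x y s t
    proof -
      obtain j i where x: "x = (j, i)" "j \<in> {1..n}" "i < m" using \<open>x \<in> J\<close> unfolding J_def by blast
      obtain k l where y: "y = (k, l)" "k \<in> {1..n}" "l < m" using \<open>y \<in> J\<close> unfolding J_def by blast
      have same: "\<gamma> j ((real i + s) / m) = \<gamma> k ((real l + t) / m)"
        using that(6) by (simp add: \<delta>_def x y)
      note ps = param[OF x(3) that(4)] and pt = param[OF y(3) that(5)]
      show ?thesis
      proof (cases "j = k")
        case False
        then show ?thesis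
          using meet[OF x(2) y(2) False ps pt same] meet[OF y(2) x(2) _ pt ps same[symmetric]]
            subdivided_edges_meet[OF x(3) that(4)] subdivided_edges_meet[OF y(3) that(5)] by blast
      next
        case True
        then have "real i + s = real l + t"
          using inj[OF x(2) ps pt] same \<open>m > 0\<close> by simp
        moreover have "real i + 1 \<le> real l \<or> real l + 1 \<le> real i"
          using that(3) True x(1) y(1) by (metis add.commute linorder_neqE_nat of_nat_Suc of_nat_le_iff Suc_leI)
        ultimately show ?thesis using that(4,5) by auto
      qed
    qed
    show "dist (\<delta> x s) (\<delta> x t) < \<mu>" if "x \<in> J" "s \<in> {0..1}" "t \<in> {0..1}" for x s t
    proof -
      obtain j i where x: "x = (j, i)" "j \<in> {1..n}" "i < m" using \<open>x \<in> J\<close> unfolding J_def by blast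
      have "\<bar>(real i + s) / m - (real i + t) / m\<bar> = \<bar>s - t\<bar> / m"
        by (simp add: diff_divide_distrib[symmetric])
      also have "\<dots> \<le> 1 / m" using that by (intro divide_right_mono) auto
      finally show ?thesis
        using fine[OF x(2) param[OF x(3) that(2)] param[OF x(3) that(3)]] by (simp add: \<delta>_def x(1))
    qed
  qed
  then interpret short_edge_graph J \<delta> \<mu> .
  have "points = G"
  proof
    show "points \<subseteq> G"
      unfolding points_def n(2) using param by (force simp: J_def \<delta>_def path_image_def)
    show "G \<subseteq> points"
    proof
      fix x assume "x \<in> G"
      then obtain j t where jt: "j \<in> {1..n}" "t \<in> {0..1}" "x = \<gamma> j t" by (auto simp: n(2) path_image_def)
      \<comment> \<open>The minimum only matters for $t = 1$, which belongs to the last piece.\<close>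
      define i where "i = min (m - 1) (nat \<lfloor>t * m\<rfloor>)"
      have "i < m" using \<open>m > 0\<close> by (simp add: i_def)
      have "t * m \<le> m" using jt(2) \<open>m > 0\<close> by (simp add: mult_left_le_one_le)
      have "t * m - i \<in> {0..1}"
      proof (cases "nat \<lfloor>t * m\<rfloor> \<le> m - 1")
        case True
        have "0 \<le> t * m" using jt(2) by simp
        then have "real i = of_int \<lfloor>t * m\<rfloor>" using True by (simp add: i_def)
        then show ?thesis using floor_correct[of "t * m"] by simp linarith
      next
        case False
        then have "i = m - 1" "real m \<le> t * m" by (auto simp: i_def le_nat_floor) linarith
        then show ?thesis using \<open>t * m \<le> m\<close> \<open>m > 0\<close> by (auto simp: of_nat_diff)
      qed
      moreover have "x = \<delta> (j, i) (t * m - i)" using jt(3) \<open>m > 0\<close> by (simp add: \<delta>_def)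
      moreover have "(j, i) \<in> J" using jt(1) \<open>i < m\<close> by (simp add: J_def)
      ultimately show "x \<in> points" using pointsI by blast
    qed
  qed
  with short_graph show ?thesis by (rule that)
qed

section \<open>Density of robustly tracing maps\<close>

text \<open>
  The retraction is fixed first, with $\<eta>$ controlled by the modulus of continuity of $f$; the mesh $\<mu>$
  comes afterwards and is controlled by the modulus of $F = r \<circ> f$.
\<close>
lemma dense_robust_tracing_graphoid:
  fixes f :: "'a::metric_space \<Rightarrow> 'a"
  assumes compact: "compact (UNIV :: 'a set)" and graphoid: "graphoid (UNIV :: 'a set)"
    and f: "continuous_on UNIV f" and e: "e > 0"
  shows "\<exists>g. continuous_on UNIV g \<and> (\<forall>x. dist (f x) (g x) < e) \<and> (\<exists>\<delta>>0. traces_robustly g \<delta> e)"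
proof -
  obtain d where d: "d > 0" "\<And>x y. dist x y < d \<Longrightarrow> dist (f x) (f y) < e / 4"
    using compact_uniformly_continuous[OF f compact] e
    unfolding uniformly_continuous_on_def by (metis UNIV_I dist_commute zero_less_divide_iff zero_less_numeral)
  define \<eta> where "\<eta> = min d (e / 8)"
  have \<eta>: "\<eta> > 0" "\<eta> \<le> d" "\<eta> \<le> e / 8" using d e by (auto simp: \<eta>_def)
  obtain G :: "'a set" and r where G: "graph G" and r: "retraction UNIV G r"
    and fibre: "\<forall>x\<in>G. diameter {y \<in> UNIV. r y = x} < \<eta>"
    using graphoid[unfolded graphoid_def, rule_format, OF \<eta>(1)] by blast
  have r_in: "r x \<in> G" and r_id: "x \<in> G \<Longrightarrow> r x = x" for x
    using r unfolding retraction_def by auto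
  have cont_r: "continuous_on UNIV r" using r by (simp add: retraction_def)
  have near_r: "dist (r x) x < \<eta>" for x
  proof -
    have "bounded {y \<in> UNIV. r y = r x}"
      using compact_imp_bounded[OF compact] bounded_subset by blast
    then have "dist (r x) x \<le> diameter {y \<in> UNIV. r y = r x}"
      by (rule diameter_bounded_bound) (auto simp: r_id r_in)
    then show ?thesis using fibre[rule_format, OF r_in[of x]] by linarith
  qed
  define F where "F x = r (f x)" for x
  have cont_F: "continuous_on UNIV F"
    unfolding F_def by (rule continuous_on_compose2[OF cont_r f]) auto
  obtain d' where d': "d' > 0" "\<And>x y. dist x y < d' \<Longrightarrow> dist (F x) (F y) < e / 16"
    using compact_uniformly_continuous[OF cont_F compact] e
    unfolding uniformly_continuous_on_def by (metis UNIV_I dist_commute zero_less_divide_iff zero_less_numeral)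
  define \<mu> where "\<mu> = min (d' / 2) (e / 24)"
  have \<mu>: "\<mu> > 0" "2 * \<mu> \<le> d'" "\<mu> \<le> e / 24" using d' e by (auto simp: \<mu>_def)
  obtain J :: "(nat \<times> nat) set" and \<gamma> where short: "short_edge_graph J \<gamma> \<mu>" and pts: "edge_graph.points J \<gamma> = G"
    using graph_imp_short_edge_graph[OF G \<mu>(1)] .
  interpret short_edge_graph J \<gamma> \<mu> by (rule short)
  obtain g where g: "continuous_on UNIV g" "\<And>x. dist (g x) (F (r x)) < 3 * \<mu> + 2 * (e / 16)"
    "\<exists>\<delta>>0. traces_robustly g \<delta> (4 * \<mu> + 2 * \<eta>)"
  proof (rule robustly_tracing_map[OF compact _ near_r])
    show "retraction UNIV points r" using r pts by simp
    show "continuous_on points F" using cont_F continuous_on_subset by blast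
    show "F ` points \<subseteq> points" using r_in pts by (auto simp: F_def)
    show "dist (F x) (F y) < e / 16" if "dist x y < 2 * \<mu>" for x y
      using d'(2) \<mu>(2) that by auto
  qed (rule that)
  have "dist (f x) (g x) < e" for x
  proof -
    have "dist (f x) (g x) \<le> dist (f x) (f (r x)) + dist (f (r x)) (F (r x)) + dist (F (r x)) (g x)"
      using dist_triangle[of "f x" "g x" "f (r x)"] dist_triangle[of "f (r x)" "g x" "F (r x)"] by linarith
    also have "dist (f x) (f (r x)) < e / 4"
      using near_r[of x] \<eta>(2) by (intro d(2)) (simp add: dist_commute)
    also have "dist (f (r x)) (F (r x)) < \<eta>"
      using near_r[of "f (r x)"] by (simp add: F_def dist_commute)
    also have "dist (F (r x)) (g x) < 3 * \<mu> + 2 * (e / 16)"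
      using g(2)[of x] by (simp add: dist_commute)
    finally show ?thesis using \<eta> \<mu> e by simp
  qed
  moreover have "\<exists>\<delta>>0. traces_robustly g \<delta> e"
    using g(3) traces_robustly_mono[of g _ "4 * \<mu> + 2 * \<eta>" e] \<eta> \<mu> e by force
  ultimately show ?thesis using g(1) by blast
qed

theorem theorem3p1:
  assumes "compact (UNIV :: 'a::metric_space set)"
    and "connected (UNIV :: 'a set)"
    and "graphoid (UNIV :: 'a set)"
  shows "generic {f :: 'a \<Rightarrow>\<^sub>C 'a. T_S_bi_shadowing (apply_bcontfun f)}"
  using assms(1) dense_robust_tracing_graphoid[OF assms(1,3)]
  by (rule generic_bi_shadowing_if_dense_robust_tracing)

end
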